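(* Let $G$ be an $n$-dimensional torus, let $\Gamma$ be a finite $d$-valent graph with vertex set $V$ equipped with a GKM action of $G$, let $T\subset G$ be a circle subgroup not contained in any $G_e$, with infinitesimal generator $\xi$, let $\phi:V\to\mathbb R$ be a $T$-moment map, let $c\in\mathbb R$ be a regular value of $\phi$, and let $f\in K_G(\Gamma)$. Then $$\chi_c(f)=\sum_{p\in V,\ \phi(p)>c}\mathrm{Res}_T f_p^{\#}.$$
   Context: Torus notation. $\mathfrak g$ is the Lie algebra of $G$, $\mathbb Z_G=\ker(\exp:\mathfrak g\to G)$, and $\mathbb Z_G^*=\{\alpha\in\mathfrak g^*:\alpha(v)\in\mathbb Z\text{ for all }v\in\mathbb Z_G\}$ is the weight lattice. For $\alpha\in\mathbb Z_G^*$, $e^{2\pi i\alpha}:G\to S^1$ is the character $\exp(x)\mapsto e^{2\pi i\alpha(x)}$. For a compact commutative Lie group $H$, $R(H)$ is the representation ring, identified with the character ring: all finite sums $\sum m_k\chi_k$ with $m_k\in\mathbb Z$ and $\chi_k:H\to S^1$ characters. Graph and action. $E$ is the set of oriented edges of $\Gamma$ (each unoriented edge gives two oriented edges). For $e\in E$, $i(e)$ and $t(e)$ are its initial and terminal vertices and $\bar e$ is $e$ with reversed orientation. $d$-valent means each vertex $p$ has exactly $d$ oriented edges $e$ with $i(e)=p$. An action of $G$ on $\Gamma$ assigns to each $e\in E$ a one-dimensional representation $\varrho_e$ with character $\chi_e=e^{2\pi i\alpha_e}$, $\alpha_e\in\mathbb Z_G^*$, and to each $p\in V$ a $d$-dimensional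 representation $\tau_p$, such that, with $G_e=\ker\chi_e$: $\tau_p\simeq\bigoplus_{i(e)=p}\varrho_e$ for all $p$; $\varrho_{\bar e}\simeq\varrho_e^*$ (so $\alpha_{\bar e}=-\alpha_e$); and $\tau_{i(e)}|_{G_e}\simeq\tau_{t(e)}|_{G_e}$ for all $e$. The action is GKM if for any two distinct oriented edges $e_1\ne e_2$ with $i(e_1)=i(e_2)$ the weights $\alpha_{e_1},\alpha_{e_2}$ are linearly independent. $K_G(\Gamma)$ is the set of functions $f:V\to R(G)$, $p\mapsto f_p$, with $r_e f_{i(e)}=r_e f_{t(e)}$ for every edge $e$, where $r_e:R(G)\to R(G_e)$ is restriction. Circle and moment map. The infinitesimal generator $\xi$ is a basis vector of the group lattice $\mathbb Z_T=\ker(\exp:\mathfrak t\to T)$ of $T$; since $T\not\subset G_e$, $\alpha_e(\xi)\ne0$ for all $e$. A $T$-moment map is a function $\phi:V\to\mathbb R$ with $\frac{\phi(t(e))-\phi(i(e))}{\alpha_e(\xi)}>0$ for all $e\in E$. A regular value $c$ is a real number not of the form $\phi(p)$. $V_c$ is the set of oriented edges $e$ with $\phi(t(e))>c>\phi(i(e))$. Definition of $\chi_c(f)$. For $e\in V_c$ let $p=i(e)$ and $\hat f_e=f_p\prod_{e'}(1-e^{2\pi i\alpha_{e'}})^{-1}$, the product over all $e'\ne e$ with $i(e')=p$. Let $\pi_e:G_e\to G/T$ be the composition of the inclusion $G_e\to G$ with the projection $G\to G/T$; it is surjective with finite kernel $W_e=G_e\cap T$. The push-forward is $((\pi_e)_*h)(\bar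 g)=\frac1{|W_e|}\sum_{w\in W_e}h(gw)$ for any $g\in G_e$ with $\pi_e(g)=\bar g$; on $R(G_e)$ it sends a representation to its $W_e$-invariant part viewed as a representation of $G/T$, and by the same formula it is extended to quotients such as $r_e\hat f_e$ (the restriction of $\hat f_e$ to $G_e$), giving functions defined generically on $G/T$. Put $f_c^{\#}(e)=(\pi_e)_*r_e\hat f_e$ and $\chi_c(f)=\sum_{e\in V_c}f_c^{\#}(e)$. Residue. $f_p^{\#}=f_p\prod_{i(e)=p}(1-e^{2\pi i\alpha_e})^{-1}$. Identify $T$ with $S^1$ by $\exp(s\xi)\leftrightarrow e^{2\pi is}$ and $T^{\mathbb C}$ with $\mathbb C\setminus\{0\}$; characters extend by $e^{2\pi i\alpha}(gz)=e^{2\pi i\alpha}(g)\,z^{\alpha(\xi)}$ for $g\in G$, $z\in\mathbb C\setminus\{0\}$. Define $$(\mathrm{Res}_T f_p^{\#})(g)=\frac1{2\pi i}\int_{C_+}f_p^{\#}(gz)\frac{dz}{z}-\frac1{2\pi i}\int_{C_-}f_p^{\#}(gz)\frac{dz}{z},$$ where $C_+$, $C_-$ are circles centered at $0$ of radius greater than one and less than one respectively, both oriented counter-clockwise (all poles in $\mathbb C\setminus\{0\}$ lie on the unit circle). This is $T$-invariant in $g$, hence a function on $G/T$. The asserted identity is one of (generically defined) functions on $G/T$. *)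

theory Defs
  imports
    "HOL-Complex_Analysis.Complex_Analysis"
    "HOL-Algebra.Coset"
    "Graph_Theory.Digraph"
    "Graph_Theory.Bidirected_Digraph"
    "Jordan_Normal_Form.Matrix"
begin

no_notation Matrix.vec_index (infixl "$" 100)

section \<open>The torus, its weights and characters\<close>

text \<open>The torus of dimension \<open>CARD('n)\<close> is \<open>(S\<^sup>1)\<^sup>n\<close> with Lie algebra \<open>real^'n\<close>. Its multiplication is
  the componentwise one of \<open>complex^'n\<close>.\<close>

definition torus :: "(complex^'n) monoid" where
  "torus = \<lparr>carrier = {g. \<forall>i. norm (g $ i) = 1}, mult = (*), one = 1\<rparr>"

definition circle_group :: "complex monoid" where
  "circle_group = \<lparr>carrier = {z. norm z = 1}, mult = (*), one = 1\<rparr>"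

definition torus_exp :: "real^'n \<Rightarrow> complex^'n" where
  "torus_exp x = (\<chi> i. cis (2 * pi * (x $ i)))"

definition torus_lattice :: "(real^'n) set" where
  "torus_lattice = {x. torus_exp x = 1}"

definition weight_lattice :: "((real^'n) \<Rightarrow>\<^sub>L real) set" where
  "weight_lattice = {a. \<forall>v\<in>torus_lattice. blinfun_apply a v \<in> \<int>}"

text \<open>The character \<open>exp x \<mapsto> e\<^bsup>2\<pi>ia(x)\<^esup>\<close>; for a weight \<open>a\<close> the choice of \<open>x\<close> is irrelevant.\<close>

definition torus_char :: "((real^'n) \<Rightarrow>\<^sub>L real) \<Rightarrow> complex^'n \<Rightarrow> complex" where
  "torus_char a g = cis (2 * pi * blinfun_apply a (SOME x. torus_exp x = g))"

abbreviation char_ker :: "((real^'n) \<Rightarrow>\<^sub>L real) \<Rightarrow> (complex^'n) set" where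
  "char_ker a \<equiv> kernel torus circle_group (torus_char a)"

definition is_character :: "(complex^'n) set \<Rightarrow> (complex^'n \<Rightarrow> complex) \<Rightarrow> bool" where
  "is_character H \<psi> \<longleftrightarrow> \<psi> \<in> hom (torus\<lparr>carrier := H\<rparr>) circle_group \<and> continuous_on H \<psi>"

text \<open>The ring \<open>R(H)\<close>. Its elements are functions on \<open>H\<close>; values outside \<open>H\<close> carry no meaning.\<close>

definition character_ring :: "(complex^'n) set \<Rightarrow> (complex^'n \<Rightarrow> complex) set" where
  "character_ring H = {f. \<exists>S (m :: (complex^'n \<Rightarrow> complex) \<Rightarrow> int). finite S \<and>
     (\<forall>\<psi>\<in>S. is_character H \<psi>) \<and> (\<forall>h\<in>H. f h = (\<Sum>\<psi>\<in>S. of_int (m \<psi>) * \<psi> h))}"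


section \<open>Matrix representations of closed subgroups of the torus\<close>

definition representation :: "(complex^'n) set \<Rightarrow> nat \<Rightarrow> (complex^'n \<Rightarrow> complex mat) \<Rightarrow> bool" where
  "representation H k \<rho> \<longleftrightarrow>
     (\<forall>g\<in>H. \<rho> g \<in> carrier_mat k k) \<and>
     \<rho> \<one>\<^bsub>torus\<^esub> = 1\<^sub>m k \<and>
     (\<forall>g\<in>H. \<forall>h\<in>H. \<rho> (g \<otimes>\<^bsub>torus\<^esub> h) = \<rho> g * \<rho> h) \<and>
     (\<forall>i<k. \<forall>j<k. continuous_on H (\<lambda>g. \<rho> g $$ (i, j)))"

definition rep_iso ::
    "(complex^'n) set \<Rightarrow> nat \<Rightarrow> (complex^'n \<Rightarrow> complex mat) \<Rightarrow> (complex^'n \<Rightarrow> complex mat) \<Rightarrow> bool" where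
  "rep_iso H k \<rho> \<sigma> \<longleftrightarrow>
     (\<exists>P \<in> carrier_mat k k. invertible_mat P \<and> (\<forall>g\<in>H. P * \<rho> g = \<sigma> g * P))"

definition rep_sum :: "(complex^'n \<Rightarrow> complex mat) list \<Rightarrow> complex^'n \<Rightarrow> complex mat" where
  "rep_sum \<rho>s g = diag_block_mat (map (\<lambda>\<rho>. \<rho> g) \<rho>s)"

definition rep_dual :: "(complex^'n \<Rightarrow> complex mat) \<Rightarrow> complex^'n \<Rightarrow> complex mat" where
  "rep_dual \<rho> g = transpose_mat (\<rho> (inv\<^bsub>torus\<^esub> g))"

definition rep_char :: "nat \<Rightarrow> (complex^'n \<Rightarrow> complex mat) \<Rightarrow> complex^'n \<Rightarrow> complex" where
  "rep_char k \<rho> g = (\<Sum>i<k. \<rho> g $$ (i, i))"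


section \<open>GKM actions on graphs\<close>

text \<open>A graph is given by its oriented edges: \<open>tail \<Gamma> e\<close> and \<open>head \<Gamma> e\<close> are the initial and terminal
  vertex of \<open>e\<close>, and \<open>bar\<close> reverses orientation (cf. \<^locale>\<open>bidirected_digraph\<close>).\<close>

definition valent :: "('v, 'e) pre_digraph \<Rightarrow> nat \<Rightarrow> bool" where
  "valent \<Gamma> d \<longleftrightarrow> (\<forall>p\<in>verts \<Gamma>. card (out_arcs \<Gamma> p) = d)"

locale graph_action =
  fixes \<Gamma> :: "('v, 'e) pre_digraph"
    and bar :: "'e \<Rightarrow> 'e"
    and d :: nat
    and \<rho> :: "'e \<Rightarrow> complex^'n \<Rightarrow> complex mat"
    and \<alpha> :: "'e \<Rightarrow> (real^'n) \<Rightarrow>\<^sub>L real"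
    and \<tau> :: "'v \<Rightarrow> complex^'n \<Rightarrow> complex mat"
  assumes rep_edge: "e \<in> arcs \<Gamma> \<Longrightarrow> representation (carrier torus) 1 (\<rho> e)"
    and weight_edge: "e \<in> arcs \<Gamma> \<Longrightarrow> \<alpha> e \<in> weight_lattice"
    and char_edge: "\<lbrakk>e \<in> arcs \<Gamma>; g \<in> carrier torus\<rbrakk> \<Longrightarrow> rep_char 1 (\<rho> e) g = torus_char (\<alpha> e) g"
    and rep_vertex: "p \<in> verts \<Gamma> \<Longrightarrow> representation (carrier torus) d (\<tau> p)"
    and vertex_decomp: "p \<in> verts \<Gamma> \<Longrightarrow>
          \<exists>es. distinct es \<and> set es = out_arcs \<Gamma> p \<and>
               rep_iso (carrier torus) d (\<tau> p) (rep_sum (map \<rho> es))"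
    and edge_reverse: "e \<in> arcs \<Gamma> \<Longrightarrow> rep_iso (carrier torus) 1 (\<rho> (bar e)) (rep_dual (\<rho> e))"
    and edge_compat: "e \<in> arcs \<Gamma> \<Longrightarrow> rep_iso (char_ker (\<alpha> e)) d (\<tau> (tail \<Gamma> e)) (\<tau> (head \<Gamma> e))"

text \<open>The clause \<open>\<alpha> e\<^sub>1 \<noteq> \<alpha> e\<^sub>2\<close> is needed because \<open>independent\<close> speaks about the set of the two weights,
  which would be a singleton otherwise.\<close>

locale GKM_action = graph_action +
  assumes GKM: "\<lbrakk>e\<^sub>1 \<in> arcs \<Gamma>; e\<^sub>2 \<in> arcs \<Gamma>; e\<^sub>1 \<noteq> e\<^sub>2; tail \<Gamma> e\<^sub>1 = tail \<Gamma> e\<^sub>2\<rbrakk> \<Longrightarrow>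
          \<alpha> e\<^sub>1 \<noteq> \<alpha> e\<^sub>2 \<and> independent {\<alpha> e\<^sub>1, \<alpha> e\<^sub>2}"

definition K_ring ::
    "('v, 'e) pre_digraph \<Rightarrow> ('e \<Rightarrow> (real^'n) \<Rightarrow>\<^sub>L real) \<Rightarrow> ('v \<Rightarrow> complex^'n \<Rightarrow> complex) set" where
  "K_ring \<Gamma> \<alpha> = {f. (\<forall>p\<in>verts \<Gamma>. f p \<in> character_ring (carrier torus)) \<and>
     (\<forall>e\<in>arcs \<Gamma>. restrict (f (tail \<Gamma> e)) (char_ker (\<alpha> e)) =
                 restrict (f (head \<Gamma> e)) (char_ker (\<alpha> e)))}"


section \<open>Circle subgroups and moment maps\<close>

definition circle_subgroup :: "(complex^'n) set \<Rightarrow> bool" where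
  "circle_subgroup T \<longleftrightarrow> (\<exists>h \<in> hom circle_group torus.
     inj_on h (carrier circle_group) \<and> continuous_on (carrier circle_group) h \<and>
     T = h ` carrier circle_group)"

definition lie_algebra :: "(complex^'n) set \<Rightarrow> (real^'n) set" where
  "lie_algebra T = {v. \<forall>s::real. torus_exp (s *\<^sub>R v) \<in> T}"

definition infinitesimal_generator :: "(complex^'n) set \<Rightarrow> real^'n \<Rightarrow> bool" where
  "infinitesimal_generator T \<xi> \<longleftrightarrow>
     \<xi> \<noteq> 0 \<and> {v \<in> lie_algebra T. torus_exp v = 1} = range (\<lambda>k::int. of_int k *\<^sub>R \<xi>)"

definition moment_map ::
    "('v, 'e) pre_digraph \<Rightarrow> ('e \<Rightarrow> (real^'n) \<Rightarrow>\<^sub>L real) \<Rightarrow> real^'n \<Rightarrow> ('v \<Rightarrow> real) \<Rightarrow> bool" where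
  "moment_map \<Gamma> \<alpha> \<xi> \<phi> \<longleftrightarrow>
     (\<forall>e\<in>arcs \<Gamma>. (\<phi> (head \<Gamma> e) - \<phi> (tail \<Gamma> e)) / blinfun_apply (\<alpha> e) \<xi> > 0)"

definition cross_edges :: "('v, 'e) pre_digraph \<Rightarrow> ('v \<Rightarrow> real) \<Rightarrow> real \<Rightarrow> 'e set" where
  "cross_edges \<Gamma> \<phi> c = {e \<in> arcs \<Gamma>. \<phi> (head \<Gamma> e) > c \<and> c > \<phi> (tail \<Gamma> e)}"


section \<open>The quotient by the circle and the push-forward\<close>

definition coset_topology :: "(complex^'n) set \<Rightarrow> (complex^'n) set topology" where
  "coset_topology T = topology (\<lambda>U. U \<subseteq> carrier (torus Mod T) \<and>
     openin (top_of_set (carrier torus)) {g \<in> carrier torus. T #>\<^bsub>torus\<^esub> g \<in> U})"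

lemma istopology_coset:
  "istopology (\<lambda>U. U \<subseteq> carrier (torus Mod T) \<and>
     openin (top_of_set (carrier torus)) {g \<in> carrier torus. T #>\<^bsub>torus\<^esub> g \<in> U})"
proof -
  have 1: "{g \<in> carrier torus. T #>\<^bsub>torus\<^esub> g \<in> U \<inter> V} =
      {g \<in> carrier torus. T #>\<^bsub>torus\<^esub> g \<in> U} \<inter> {g \<in> carrier torus. T #>\<^bsub>torus\<^esub> g \<in> V}" for U V
    by auto
  have 2: "{g \<in> carrier torus. T #>\<^bsub>torus\<^esub> g \<in> \<Union>\<U>} =
      (\<Union>U\<in>\<U>. {g \<in> carrier torus. T #>\<^bsub>torus\<^esub> g \<in> U})" for \<U>
    by auto
  show ?thesis
    unfolding istopology_def 1 2 by auto
qed

lemma openin_coset_topology: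
  "openin (coset_topology T) U \<longleftrightarrow> U \<subseteq> carrier (torus Mod T) \<and>
     openin (top_of_set (carrier torus)) {g \<in> carrier torus. T #>\<^bsub>torus\<^esub> g \<in> U}"
  unfolding coset_topology_def topology_inverse'[OF istopology_coset] ..

text \<open>The push-forward along \<open>H \<rightarrow> G \<rightarrow> G/T\<close>, for \<open>H \<rightarrow> G/T\<close> surjective with finite kernel \<open>H \<inter> T\<close>.
  The value does not depend on the preimage \<open>g\<close> of the coset \<open>X\<close>.\<close>

definition push_forward ::
    "(complex^'n) set \<Rightarrow> (complex^'n) set \<Rightarrow> (complex^'n \<Rightarrow> complex) \<Rightarrow> (complex^'n) set \<Rightarrow> complex" where
  "push_forward T H h X =
     (let g = (SOME g. g \<in> H \<and> T #>\<^bsub>torus\<^esub> g = X)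
      in 1 / of_nat (card (H \<inter> T)) * (\<Sum>w\<in>H \<inter> T. h (g \<otimes>\<^bsub>torus\<^esub> w)))"

definition f_hat :: "('v, 'e) pre_digraph \<Rightarrow> ('e \<Rightarrow> (real^'n) \<Rightarrow>\<^sub>L real) \<Rightarrow>
    ('v \<Rightarrow> complex^'n \<Rightarrow> complex) \<Rightarrow> 'e \<Rightarrow> complex^'n \<Rightarrow> complex" where
  "f_hat \<Gamma> \<alpha> f e g =
     f (tail \<Gamma> e) g * (\<Prod>e'\<in>out_arcs \<Gamma> (tail \<Gamma> e) - {e}. inverse (1 - torus_char (\<alpha> e') g))"

definition f_sharp_edge :: "('v, 'e) pre_digraph \<Rightarrow> ('e \<Rightarrow> (real^'n) \<Rightarrow>\<^sub>L real) \<Rightarrow> (complex^'n) set \<Rightarrow>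
    ('v \<Rightarrow> complex^'n \<Rightarrow> complex) \<Rightarrow> 'e \<Rightarrow> (complex^'n) set \<Rightarrow> complex" where
  "f_sharp_edge \<Gamma> \<alpha> T f e =
     push_forward T (char_ker (\<alpha> e)) (restrict (f_hat \<Gamma> \<alpha> f e) (char_ker (\<alpha> e)))"

definition chi_c :: "('v, 'e) pre_digraph \<Rightarrow> ('e \<Rightarrow> (real^'n) \<Rightarrow>\<^sub>L real) \<Rightarrow> (complex^'n) set \<Rightarrow>
    ('v \<Rightarrow> real) \<Rightarrow> real \<Rightarrow> ('v \<Rightarrow> complex^'n \<Rightarrow> complex) \<Rightarrow> (complex^'n) set \<Rightarrow> complex" where
  "chi_c \<Gamma> \<alpha> T \<phi> c f X = (\<Sum>e\<in>cross_edges \<Gamma> \<phi> c. f_sharp_edge \<Gamma> \<alpha> T f e X)"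

text \<open>The points of \<open>G/T\<close> at which no denominator occurring in \<^const>\<open>chi_c\<close> vanishes, so that the
  totalised \<^const>\<open>inverse\<close> has its usual meaning there.\<close>

definition chi_c_domain :: "('v, 'e) pre_digraph \<Rightarrow> ('e \<Rightarrow> (real^'n) \<Rightarrow>\<^sub>L real) \<Rightarrow> (complex^'n) set \<Rightarrow>
    ('v \<Rightarrow> real) \<Rightarrow> real \<Rightarrow> (complex^'n) set set" where
  "chi_c_domain \<Gamma> \<alpha> T \<phi> c = {X \<in> carrier (torus Mod T).
     \<forall>e\<in>cross_edges \<Gamma> \<phi> c. \<forall>h\<in>X \<inter> char_ker (\<alpha> e).
       \<forall>e'\<in>out_arcs \<Gamma> (tail \<Gamma> e) - {e}. torus_char (\<alpha> e') h \<noteq> 1}"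


section \<open>The residue\<close>

text \<open>The value of the character \<open>a\<close> at \<open>gz\<close>, where \<open>z\<close> lies in the complexified circle
  \<open>T\<^sup>\<complex> = \<complex> - {0}\<close>. For a weight \<open>a\<close> the number \<open>a(\<xi>)\<close> is an integer, so the floor only changes its type.\<close>

definition char_ext :: "real^'n \<Rightarrow> ((real^'n) \<Rightarrow>\<^sub>L real) \<Rightarrow> complex^'n \<Rightarrow> complex \<Rightarrow> complex" where
  "char_ext \<xi> a g z = torus_char a g * z powi \<lfloor>blinfun_apply a \<xi>\<rfloor>"

text \<open>The value at \<open>gz\<close> of an element of \<open>R(G)\<close>, by linear extension of \<^const>\<open>char_ext\<close>.\<close>

definition ring_ext :: "real^'n \<Rightarrow> (complex^'n \<Rightarrow> complex) \<Rightarrow> complex^'n \<Rightarrow> complex \<Rightarrow> complex" where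
  "ring_ext \<xi> F g z = (THE y. \<exists>A (m :: ((real^'n) \<Rightarrow>\<^sub>L real) \<Rightarrow> int). finite A \<and> A \<subseteq> weight_lattice \<and>
     (\<forall>h\<in>carrier torus. F h = (\<Sum>a\<in>A. of_int (m a) * torus_char a h)) \<and>
     y = (\<Sum>a\<in>A. of_int (m a) * char_ext \<xi> a g z))"

definition f_sharp :: "('v, 'e) pre_digraph \<Rightarrow> ('e \<Rightarrow> (real^'n) \<Rightarrow>\<^sub>L real) \<Rightarrow> real^'n \<Rightarrow>
    ('v \<Rightarrow> complex^'n \<Rightarrow> complex) \<Rightarrow> 'v \<Rightarrow> complex^'n \<Rightarrow> complex \<Rightarrow> complex" where
  "f_sharp \<Gamma> \<alpha> \<xi> f p g z =
     ring_ext \<xi> (f p) g z * (\<Prod>e\<in>out_arcs \<Gamma> p. inverse (1 - char_ext \<xi> (\<alpha> e) g z))"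

text \<open>Here \<open>F g z\<close> stands for the value of a function at \<open>gz\<close>, and \<open>r\<^sub>1 > 1 > r\<^sub>2 > 0\<close> are the radii
  of \<open>C\<^sub>+\<close> and \<open>C\<^sub>-\<close>.\<close>

definition Res_T :: "real \<Rightarrow> real \<Rightarrow> (complex^'n \<Rightarrow> complex \<Rightarrow> complex) \<Rightarrow> complex^'n \<Rightarrow> complex" where
  "Res_T r\<^sub>1 r\<^sub>2 F g =
     1 / (2 * of_real pi * \<i>) * contour_integral (circlepath 0 r\<^sub>1) (\<lambda>z. F g z / z) -
     1 / (2 * of_real pi * \<i>) * contour_integral (circlepath 0 r\<^sub>2) (\<lambda>z. F g z / z)"

end

theory Submission
  imports Defs "Jordan_Normal_Form.Char_Poly"
begin

text \<open>For generic \<open>g\<close> the poles of \<open>z \<mapsto> f\<^sub>p\<^sup>#(gz)/z\<close> on the unit circle are simple, one family of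
  \<open>\<bar>\<alpha>\<^sub>e(\<xi>)\<bar>\<close> points for each edge \<open>e\<close> out of \<open>p\<close>, and the residue theorem gives
  \<open>Res\<^sub>T f\<^sub>p\<^sup># = - \<Sum> sgn (\<alpha>\<^sub>e(\<xi>)) f\<^sub>c\<^sup>#(e)\<close>, summed over these edges. The terms of \<open>e\<close> and of its
  reverse have equal \<open>f\<^sub>c\<^sup>#\<close>, because \<open>f\<close> and the isotropy characters at the two ends agree on \<open>G\<^sub>e\<close>, and
  opposite signs. So edges inside \<open>{\<phi> > c}\<close> cancel and the edges crossing \<open>c\<close> remain. Translating any
  point along a suitable one-parameter subgroup makes it generic, and both sides are continuous along
  it where they are defined; this gives density of the domain and extends the identity to all of it.\<close>

text \<open>Three difficulties shape the argument. The isotropy data are given only up to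
  isomorphism of matrix representations, so the characters at the two ends of an edge cannot be
  matched one by one. Characteristic polynomials serve as the common invariant, and they retain the
  product of all remaining \<open>1 - \<chi>\<close> once the trivial factor is removed. Second,
  genericity rests on the functional \<open>deg e' * \<alpha> e - deg e * \<alpha> e'\<close>: it
  vanishes on \<xi>, a common root of the two edges forces an integral value of it, and the GKM
  condition makes it nonzero. Any direction off finitely many hyperplanes then works, the same one
  for every starting point. Third, the two sides are continuous for different reasons. The contours
  keep away from the unit circle, where all nonzero poles lie, even when poles collide; an edge term
  is a finite sum over roots that move along the path. Correcting the direction by a multiple of
  \<xi>, so that it lies in the kernel of \<open>\<alpha> e\<close>, turns this into a sum over the
  fixed roots at the starting point.\<close>

no_notation fps_nth (infixl "$" 75)

section \<open>Characters of the torus\<close>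

lemmas cart_eq_iff = Finite_Cartesian_Product.vec_eq_iff

text \<open>The deviation \<open>E\<close> from linearity is additive and vanishes at 1, hence at
  every rational; continuity and density do the rest.\<close>

lemma continuous_additive_real:
  fixes D :: "real \<Rightarrow> 'a::real_normed_vector"
  assumes cont: "continuous_on UNIV D" and add: "\<And>x y. D (x + y) = D x + D y"
  shows "D x = x *\<^sub>R D 1"
proof -
  interpret additive D by standard (rule add)
  define E where "E x = D x - x *\<^sub>R D 1" for x
  interpret E: additive E
    by standard (simp add: E_def add scaleR_left_distrib)
  have nat: "E (of_nat n * y) = of_nat n *\<^sub>R E y" for n y
    by (induction n) (simp_all add: E.zero E.add scaleR_left_distrib distrib_right)
  have int: "E (of_int n * y) = of_int n *\<^sub>R E y" for n y
    by (cases n rule: int_cases2) (use nat in \<open>simp_all add: E.minus\<close>)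
  have "E q = 0" if q: "q \<in> \<rat>" for q
  proof -
    obtain a b :: int where ab: "b > 0" "q = of_int a / of_int b"
      using q by (metis Rats_cases')
    have "of_int b *\<^sub>R E q = E (of_int b * q)"
      by (rule int[symmetric])
    also have "\<dots> = E (of_int a * 1)"
      using ab by simp
    also have "\<dots> = 0"
      by (simp only: int) (simp add: E_def)
    finally show ?thesis using ab by simp
  qed
  moreover have "continuous_on (closure \<rat>) E"
    unfolding Rats_closure_real E_def using cont by (intro continuous_intros)
  ultimately have "E x = 0"
    using continuous_constant_on_closure[of \<rat> E 0 x] Rats_closure_real by auto
  then show ?thesis by (simp add: E_def)
qed

text \<open>The real line is contractible, so the character has a continuous logarithm. The failure
  of its imaginary part to be additive is continuous with values in the multiples of 2 pi, hence
  constant; subtracting the value at 0 leaves an additive function.\<close>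

lemma continuous_real_character:
  fixes \<psi> :: "real \<Rightarrow> complex"
  assumes cont: "continuous_on UNIV \<psi>" and mult: "\<And>x y. \<psi> (x + y) = \<psi> x * \<psi> y"
    and norm: "\<And>x. norm (\<psi> x) = 1"
  obtains c where "\<And>x. \<psi> x = cis (2 * pi * (c * x))"
proof -
  obtain L where L: "continuous_on UNIV L" "\<And>x. \<psi> x = exp (L x)"
    using continuous_logarithm_on_contractible[OF cont]
    by (metis contractible_UNIV norm norm_zero zero_neq_one UNIV_I)
  have Lim: "Im (L (x + y)) - Im (L x) - Im (L y) = - Im (L 0)" for x y
  proof -
    define K where "K x = Im (L (x + y)) - Im (L x) - Im (L y)" for x
    have contK: "continuous_on UNIV K"
      unfolding K_def by (intro continuous_intros continuous_on_compose2[OF L(1)]) auto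
    have expK: "cis (K x) = 1" for x
    proof -
      have 1: "cis (Im (L x)) = \<psi> x" for x
        using norm[of x] L(2)[of x] by (auto simp: exp_eq_polar norm_mult)
      show ?thesis
        using mult[of x y] norm[of x] norm[of y]
        by (auto simp: K_def 1 simp flip: cis_divide)
    qed
    have K_int: "\<exists>n::int. K x = 2 * pi * n" for x
      using expK[of x] by (metis cis.sel(1) cos_one_2pi_int mult.commute one_complex.sel(1) mult.assoc)
    have "K constant_on UNIV"
    proof (rule continuous_discrete_range_constant[OF connected_UNIV contK])
      fix x :: real
      show "\<exists>e>0. \<forall>y. y \<in> UNIV \<and> K y \<noteq> K x \<longrightarrow> e \<le> norm (K y - K x)"
      proof (intro exI[of _ "2 * pi"] conjI allI impI)
        fix y assume y: "y \<in> UNIV \<and> K y \<noteq> K x"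
        obtain m n :: int where mn: "K y = 2 * pi * m" "K x = 2 * pi * n"
          using K_int by metis
        with y have "m \<noteq> n" by auto
        then have "\<bar>real_of_int (m - n)\<bar> \<ge> 1" by linarith
        then show "2 * pi \<le> norm (K y - K x)"
          by (simp add: mn flip: right_diff_distrib of_int_diff) (simp add: abs_mult)
      qed auto
    qed
    then have "K x = K 0"
      by (auto simp: constant_on_def)
    then show ?thesis by (simp add: K_def)
  qed
  define M where "M x = Im (L x) - Im (L 0)" for x
  have Madd: "M (x + y) = M x + M y" for x y
    using Lim[of x y] by (simp add: M_def)
  have "continuous_on UNIV M"
    unfolding M_def by (intro continuous_intros L)
  from continuous_additive_real[OF this Madd] have M: "M x = x * M 1" for x
    by (metis real_scaleR_def)
  have "\<psi> x = cis (2 * pi * ((M 1 / (2 * pi)) * x))" for x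
  proof -
    have \<psi>: "\<psi> x = cis (Im (L x))" for x
      using norm[of x] L(2)[of x] by (auto simp: exp_eq_polar norm_mult)
    have "\<psi> 0 = 1"
      using mult[of 0 0] norm[of 0] by auto
    then have "\<psi> x = cis (M x)"
      by (metis \<psi> M_def cis_divide div_by_1)
    then show ?thesis by (simp add: M[of x] mult.commute)
  qed
  then show ?thesis by (rule that)
qed

section \<open>The torus as a group, its exponential map and its weights\<close>

lemma carrier_torus: "g \<in> carrier torus \<longleftrightarrow> (\<forall>i. norm (g $ i) = 1)"
  by (simp add: torus_def)

lemma torus_mult [simp]: "x \<otimes>\<^bsub>torus\<^esub> y = x * y" and torus_one [simp]: "\<one>\<^bsub>torus\<^esub> = 1"
  by (simp_all add: torus_def)

lemma carrier_circle_group [simp]: "z \<in> carrier circle_group \<longleftrightarrow> norm z = 1"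
  and circle_mult [simp]: "x \<otimes>\<^bsub>circle_group\<^esub> y = x * y"
  and circle_one [simp]: "\<one>\<^bsub>circle_group\<^esub> = 1"
  by (simp_all add: circle_group_def)

lemma group_torus: "group (torus :: (complex^'n) monoid)"
proof (rule groupI)
  fix x :: "complex^'n" assume "x \<in> carrier torus"
  then show "\<exists>y\<in>carrier torus. y \<otimes>\<^bsub>torus\<^esub> x = \<one>\<^bsub>torus\<^esub>"
    by (intro bexI[of _ "\<chi> i. inverse (x $ i)"])
       (auto simp: carrier_torus cart_eq_iff norm_inverse, metis left_inverse norm_zero zero_neq_one)
qed (auto simp: carrier_torus norm_mult mult.assoc)

interpretation torus: comm_group "torus :: (complex^'n) monoid"
  by (rule group.group_comm_groupI[OF group_torus]) (simp add: mult.commute)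

lemma torus_mult_closed: "x \<in> carrier torus \<Longrightarrow> y \<in> carrier torus \<Longrightarrow> x * y \<in> carrier torus"
  using torus.m_closed by simp

lemma torus_mult_cancel_left: "g \<in> carrier torus \<Longrightarrow> g * x = g * y \<longleftrightarrow> x = y"
  unfolding cart_eq_iff carrier_torus by (metis mult_cancel_left norm_zero vector_mult_component zero_neq_one)

lemma torus_exp_nth [simp]: "torus_exp x $ i = cis (2 * pi * (x $ i))"
  by (simp add: torus_exp_def)

lemma torus_exp_in_carrier [simp]: "torus_exp x \<in> carrier torus"
  by (simp add: carrier_torus)

lemma torus_exp_zero [simp]: "torus_exp 0 = 1"
  by (simp add: cart_eq_iff)

lemma torus_exp_add: "torus_exp (x + y) = torus_exp x * torus_exp y"
  by (simp add: cart_eq_iff cis_mult distrib_left)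

lemma torus_exp_surj:
  assumes "g \<in> carrier torus" obtains x where "torus_exp x = g"
proof -
  have "torus_exp (\<chi> i. Arg (g $ i) / (2 * pi)) = g"
    unfolding cart_eq_iff
  proof
    fix i
    have "norm (g $ i) = 1" "g $ i \<noteq> 0"
      using assms by (auto simp: carrier_torus) (metis norm_zero zero_neq_one)
    then show "torus_exp (\<chi> i. Arg (g $ i) / (2 * pi)) $ i = g $ i"
      by (simp add: cis_Arg sgn_eq)
  qed
  then show ?thesis by (rule that)
qed

lemma cis_2pi_eq_1_iff: "cis (2 * pi * x) = 1 \<longleftrightarrow> x \<in> \<int>"
proof
  assume "cis (2 * pi * x) = 1"
  then have "cos (2 * pi * x) = 1"
    by (metis cis.sel(1) one_complex.sel(1))
  then show "x \<in> \<int>"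
    by (auto simp: cos_one_2pi_int)
qed simp

lemma torus_lattice_iff: "x \<in> torus_lattice \<longleftrightarrow> (\<forall>i. x $ i \<in> \<int>)"
  by (simp add: torus_lattice_def cart_eq_iff cis_2pi_eq_1_iff)

lemma weight_axis:
  assumes "a \<in> weight_lattice" shows "blinfun_apply a (axis i 1) \<in> \<int>"
proof -
  have "axis i 1 \<in> torus_lattice" by (simp add: torus_lattice_iff axis_def)
  then show ?thesis using assms by (auto simp: weight_lattice_def)
qed

lemma blinfun_apply_axis_sum: fixes a :: "(real^'n) \<Rightarrow>\<^sub>L real"
  shows "blinfun_apply a x = (\<Sum>i\<in>UNIV. x $ i * blinfun_apply a (axis i 1))"
proof -
  have "blinfun_apply a x = blinfun_apply a (\<Sum>i\<in>UNIV. (x $ i) *\<^sub>R axis i 1)"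
    by (subst basis_expansion[symmetric, of x]) (simp add: scalar_mult_eq_scaleR)
  then show ?thesis
    by (simp add: blinfun.sum_right blinfun.scaleR_right)
qed

text \<open>Two logarithms of one point differ by an element of the lattice, where a weight is
  integral, so the choice hidden in \<open>torus_char\<close> does not matter.\<close>

lemma torus_char_exp:
  assumes "a \<in> weight_lattice"
  shows "torus_char a (torus_exp x) = cis (2 * pi * blinfun_apply a x)"
proof -
  define y where "y = (SOME y. torus_exp y = torus_exp x)"
  have "torus_exp y = torus_exp x"
    unfolding y_def by (rule someI[of _ x]) simp
  then have "torus_exp (y - x) = 1"
    by (simp add: cart_eq_iff right_diff_distrib flip: cis_divide)
  then have "blinfun_apply a (y - x) \<in> \<int>"
    using assms by (simp add: weight_lattice_def torus_lattice_def)
  then have "cis (2 * pi * blinfun_apply a y - 2 * pi * blinfun_apply a x) = 1"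
    by (simp only: cis_2pi_eq_1_iff blinfun.diff_right flip: right_diff_distrib)
  then have "cis (2 * pi * blinfun_apply a y) = cis (2 * pi * blinfun_apply a x)"
    by (simp flip: cis_divide)
  then show ?thesis by (simp add: torus_char_def y_def)
qed

lemma torus_char_mult:
  assumes "a \<in> weight_lattice" "g \<in> carrier torus" "h \<in> carrier torus"
  shows "torus_char a (g * h) = torus_char a g * torus_char a h"
proof -
  obtain x y where "g = torus_exp x" "h = torus_exp y"
    using assms torus_exp_surj by metis
  then show ?thesis
    using assms(1) by (simp add: torus_char_exp blinfun.add_right distrib_left cis_mult flip: torus_exp_add)
qed

lemma norm_torus_char [simp]: "norm (torus_char a g) = 1"
  by (simp add: torus_char_def)

lemma torus_char_nonzero [simp]: "torus_char a g \<noteq> 0"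
  by (simp add: torus_char_def)

lemma torus_char_one [simp]: assumes "a \<in> weight_lattice" shows "torus_char a 1 = 1"
  using torus_char_exp[OF assms, of 0] by (simp add: blinfun.zero_right)

text \<open>In coordinates a character is a Laurent monomial whose exponents are the values of the
  weight on the standard basis. This form shows continuity, which the definition through a chosen
  logarithm hides.\<close>

lemma torus_char_eq_prod:
  assumes "a \<in> weight_lattice" "g \<in> carrier torus"
  shows "torus_char a g = (\<Prod>i\<in>UNIV. (g $ i) powi \<lfloor>blinfun_apply a (axis i 1)\<rfloor>)"
proof -
  obtain x where g: "g = torus_exp x" using assms torus_exp_surj by metis
  have fl: "real_of_int \<lfloor>blinfun_apply a (axis i 1)\<rfloor> = blinfun_apply a (axis i 1)" for i
    using weight_axis[OF assms(1), of i] by (auto elim: Ints_cases)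
  have prod_cis: "(\<Prod>i\<in>S. cis (f i)) = cis (\<Sum>i\<in>S. f i)" for f :: "'a \<Rightarrow> real" and S
    by (induction S rule: infinite_finite_induct) (simp_all add: cis_mult)
  show ?thesis
    by (simp add: g torus_char_exp[OF assms(1)] cis_power_int fl prod_cis
        blinfun_apply_axis_sum[of a x] sum_distrib_left mult_ac)
qed

lemma continuous_on_torus_char:
  assumes "a \<in> weight_lattice" shows "continuous_on (carrier torus) (torus_char a)"
proof -
  have nz: "g $ i \<noteq> 0" if "g \<in> carrier torus" for g :: "complex^'a" and i
    using that unfolding carrier_torus by (metis norm_zero zero_neq_one)
  have "continuous_on (carrier torus)
      (\<lambda>g. \<Prod>i\<in>UNIV. (g $ i) powi \<lfloor>blinfun_apply a (axis i 1)\<rfloor>)"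
    by (intro continuous_intros) (use nz in blast)
  then show ?thesis
    by (rule continuous_on_eq) (simp add: torus_char_eq_prod assms)
qed

lemma mem_char_ker: "g \<in> char_ker a \<longleftrightarrow> g \<in> carrier torus \<and> torus_char a g = 1"
  by (simp add: kernel_def)

lemma continuous_on_torus_exp [continuous_intros]:
  "continuous_on S f \<Longrightarrow> continuous_on S (\<lambda>x. torus_exp (f x))"
  unfolding torus_exp_def cis_conv_exp by (intro continuous_intros)

lemma compact_carrier_torus: "compact (carrier (torus :: (complex^'n) monoid))"
proof (rule compact_eq_bounded_closed[THEN iffD2, OF conjI])
  show "bounded (carrier (torus :: (complex^'n) monoid))"
  proof (rule boundedI)
    fix g :: "complex^'n" assume "g \<in> carrier torus"
    then have "(\<Sum>i\<in>UNIV. norm (g $ i)) = real CARD('n)"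
      by (simp add: carrier_torus)
    then show "norm g \<le> real CARD('n)"
      unfolding norm_vec_def by (metis L2_set_le_sum norm_ge_zero)
  qed
  have "carrier (torus :: (complex^'n) monoid) = (\<Inter>i. {g. norm (g $ i) = 1})"
    by (auto simp: carrier_torus)
  also have "closed \<dots>"
    by (intro closed_INT ballI closed_Collect_eq continuous_intros)
  finally show "closed (carrier (torus :: (complex^'n) monoid))" .
qed

lemma continuous_vector_character:
  fixes \<psi> :: "real^'n \<Rightarrow> complex"
  assumes cont: "continuous_on UNIV \<psi>" and mult: "\<And>x y. \<psi> (x + y) = \<psi> x * \<psi> y"
    and norm: "\<And>x. norm (\<psi> x) = 1"
  obtains a :: "(real^'n) \<Rightarrow>\<^sub>L real" where "\<And>x. \<psi> x = cis (2 * pi * blinfun_apply a x)"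
proof -
  have "\<exists>c. \<forall>s. \<psi> (s *\<^sub>R axis i 1) = cis (2 * pi * (c * s))" for i
  proof -
    have "continuous_on UNIV (\<lambda>s::real. \<psi> (s *\<^sub>R axis i 1))"
      by (intro continuous_on_compose2[OF cont] continuous_intros) auto
    from continuous_real_character[OF this] show ?thesis
      by (metis mult norm scaleR_left_distrib)
  qed
  then obtain c where c: "\<psi> (s *\<^sub>R axis i 1) = cis (2 * pi * (c i * s))" for i s
    by metis
  have \<psi>0: "\<psi> 0 = 1"
    using mult[of 0 0] norm[of 0] by auto
  have "\<psi> x = cis (2 * pi * blinfun_apply (blinfun_inner_left (\<chi> i. c i)) x)" for x
  proof -
    have "\<psi> (\<Sum>i\<in>S. (x $ i) *\<^sub>R axis i 1) = cis (2 * pi * (\<Sum>i\<in>S. c i * (x $ i)))" for S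
      by (induction S rule: infinite_finite_induct)
         (simp_all add: \<psi>0 mult c cis_mult distrib_left)
    from this[of UNIV] show ?thesis
      using basis_expansion[of x] by (simp add: scalar_mult_eq_scaleR inner_vec_def mult.commute)
  qed
  then show ?thesis by (rule that)
qed

text \<open>Pulled back along the exponential map, the character becomes one of a real vector space
  and so has a linear exponent; triviality on the lattice makes that exponent a weight.\<close>

lemma is_character_torus:
  assumes "is_character (carrier torus) \<psi>"
  shows "\<exists>a\<in>weight_lattice. \<forall>g\<in>carrier torus. \<psi> g = torus_char a g"
proof -
  have hom: "\<psi> (g * h) = \<psi> g * \<psi> h" if "g \<in> carrier torus" "h \<in> carrier torus" for g h
    using assms that unfolding is_character_def hom_def by auto
  have norm: "norm (\<psi> g) = 1" if "g \<in> carrier torus" for g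
    using assms that unfolding is_character_def hom_def by auto
  have cont: "continuous_on (carrier torus) \<psi>"
    using assms by (simp add: is_character_def)
  have "continuous_on UNIV (\<lambda>x. \<psi> (torus_exp x))"
    by (rule continuous_on_compose2[OF cont]) (auto intro!: continuous_intros)
  then obtain a where a: "\<And>x. \<psi> (torus_exp x) = cis (2 * pi * blinfun_apply a x)"
    by (rule continuous_vector_character) (auto simp: torus_exp_add hom norm)
  have weight: "a \<in> weight_lattice"
    unfolding weight_lattice_def torus_lattice_def
  proof clarify
    fix v :: "real^'a" assume "torus_exp v = 1"
    then have "cis (2 * pi * blinfun_apply a v) = 1"
      using a[of v] a[of 0] by (simp add: blinfun.zero_right)
    then show "blinfun_apply a v \<in> \<int>" by (simp only: cis_2pi_eq_1_iff)
  qed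
  show ?thesis
  proof (intro bexI[OF _ weight] ballI)
    fix g :: "complex^'a" assume "g \<in> carrier torus"
    then obtain x where "torus_exp x = g" by (rule torus_exp_surj)
    with a[of x] show "\<psi> g = torus_char a g"
      using torus_char_exp[OF weight] by metis
  qed
qed

text \<open>The functions \<psi> are constrained only on the torus, so several of them may have the
  same weight. Their coefficients are therefore added up over the fibres of the assignment of
  weights.\<close>

lemma character_ring_torusE:
  fixes F :: "complex^'n \<Rightarrow> complex"
  assumes "F \<in> character_ring (carrier torus)"
  obtains A and m :: "((real^'n) \<Rightarrow>\<^sub>L real) \<Rightarrow> int" where "finite A" "A \<subseteq> weight_lattice"
    "\<And>h. h \<in> carrier torus \<Longrightarrow> F h = (\<Sum>a\<in>A. of_int (m a) * torus_char a h)"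
proof -
  obtain S and m :: "(complex^'n \<Rightarrow> complex) \<Rightarrow> int" where S: "finite S"
    "\<And>\<psi>. \<psi> \<in> S \<Longrightarrow> is_character (carrier torus) \<psi>"
    "\<And>h. h \<in> carrier torus \<Longrightarrow> F h = (\<Sum>\<psi>\<in>S. of_int (m \<psi>) * \<psi> h)"
    using assms unfolding character_ring_def by blast
  have "\<forall>\<psi>\<in>S. \<exists>a. a \<in> weight_lattice \<and> (\<forall>g\<in>carrier torus. \<psi> g = torus_char a g)"
    using is_character_torus[OF S(2)] by blast
  then obtain a where a: "\<And>\<psi>. \<psi> \<in> S \<Longrightarrow> a \<psi> \<in> weight_lattice"
    "\<And>\<psi> g. \<psi> \<in> S \<Longrightarrow> g \<in> carrier torus \<Longrightarrow> \<psi> g = torus_char (a \<psi>) g"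
    by (auto dest!: bchoice)
  show ?thesis
  proof (rule that[of "a ` S" "\<lambda>b. \<Sum>\<psi> | \<psi> \<in> S \<and> a \<psi> = b. m \<psi>"])
    fix h :: "complex^'n" assume h: "h \<in> carrier torus"
    have "F h = (\<Sum>\<psi>\<in>S. of_int (m \<psi>) * torus_char (a \<psi>) h)"
      using S(3)[OF h] a(2) h by simp
    also have "\<dots> = (\<Sum>b\<in>a ` S. \<Sum>\<psi> | \<psi> \<in> S \<and> a \<psi> = b. of_int (m \<psi>) * torus_char (a \<psi>) h)"
      by (rule sum.image_gen[OF S(1)])
    also have "\<dots> = (\<Sum>b\<in>a ` S. of_int (\<Sum>\<psi> | \<psi> \<in> S \<and> a \<psi> = b. m \<psi>) * torus_char b h)"
      by (intro sum.cong refl) (simp add: sum_distrib_right)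
    finally show "F h = \<dots>" .
  qed (use S(1) a(1) in auto)
qed

text \<open>For \<open>\<xi>\<close> in the lattice, \<open>cis (2\<pi>s) \<mapsto> torus_exp (s\<xi>)\<close> is componentwise an integer power.\<close>

definition circle_param :: "real^'n \<Rightarrow> complex \<Rightarrow> complex^'n" where
  "circle_param \<xi> z = (\<chi> i. z powi \<lfloor>\<xi> $ i\<rfloor>)"

lemma unit_complex_cis:
  fixes z :: complex
  assumes "norm z = 1" obtains s :: real where "z = cis (2 * pi * s)"
proof
  have "z \<noteq> 0" using assms by auto
  then show "z = cis (2 * pi * (Arg z / (2 * pi)))"
    using assms by (simp add: cis_Arg sgn_eq)
qed

lemma range_cis: "range (\<lambda>s. cis (2 * pi * s)) = sphere 0 1"
proof (intro equalityI subsetI)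
  fix z :: complex assume "z \<in> sphere 0 1"
  then have "norm z = 1" by simp
  then obtain s where "z = cis (2 * pi * s)" by (rule unit_complex_cis)
  then show "z \<in> range (\<lambda>s. cis (2 * pi * s))" by (rule range_eqI)
qed auto

lemma circle_param_cis:
  assumes "\<xi> \<in> torus_lattice"
  shows "circle_param \<xi> (cis (2 * pi * s)) = torus_exp (s *\<^sub>R \<xi>)"
proof -
  have fl: "real_of_int \<lfloor>\<xi> $ i\<rfloor> = \<xi> $ i" for i
    using assms unfolding torus_lattice_iff by (metis Ints_cases floor_of_int)
  show ?thesis
    by (simp add: circle_param_def cart_eq_iff cis_power_int mult_ac fl)
qed

lemma circle_param_in_carrier: "norm z = 1 \<Longrightarrow> circle_param \<xi> z \<in> carrier torus"
  by (simp add: circle_param_def carrier_torus norm_power_int)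

lemma circle_param_mult: "circle_param \<xi> (z * w) = circle_param \<xi> z * circle_param \<xi> w"
  by (simp add: circle_param_def cart_eq_iff power_int_mult_distrib)

lemma weight_on_lattice:
  "a \<in> weight_lattice \<Longrightarrow> \<xi> \<in> torus_lattice \<Longrightarrow> of_int \<lfloor>blinfun_apply a \<xi>\<rfloor> = blinfun_apply a \<xi>"
  unfolding weight_lattice_def by (auto elim: Ints_cases)

text \<open>On the unit circle the formal extension is evaluation at an actual point of the torus.
  This links the contour integrals with the push-forward.\<close>

lemma torus_char_circle_param:
  assumes "a \<in> weight_lattice" "\<xi> \<in> torus_lattice" "g \<in> carrier torus" "norm z = 1"
  shows "torus_char a (g * circle_param \<xi> z) = char_ext \<xi> a g z"
proof -
  obtain s where z: "z = cis (2 * pi * s)" using assms(4) by (rule unit_complex_cis)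
  have "torus_char a (circle_param \<xi> z) = cis (2 * pi * (s * blinfun_apply a \<xi>))"
    unfolding z circle_param_cis[OF assms(2)] torus_char_exp[OF assms(1)]
    by (simp add: blinfun.scaleR_right)
  then show ?thesis
    using assms
    by (simp add: torus_char_mult circle_param_in_carrier char_ext_def z cis_power_int mult_ac
        weight_on_lattice[OF assms(1,2)])
qed

lemma holomorphic_on_char_ext:
  "0 \<notin> S \<Longrightarrow> (\<lambda>z. char_ext \<xi> a g z) holomorphic_on S"
  unfolding char_ext_def by (intro holomorphic_intros) auto

text \<open>The identity theorem: the punctured plane is connected and the unit circle accumulates
  at 1.\<close>

lemma holomorphic_eq_off_zero:
  fixes P Q :: "complex \<Rightarrow> complex"
  assumes "P holomorphic_on -{0}" "Q holomorphic_on -{0}"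
    and "\<And>z. norm z = 1 \<Longrightarrow> P z = Q z" "w \<noteq> 0"
  shows "P w = Q w"
proof -
  have "(1::complex) islimpt sphere 0 1"
  proof (rule connected_imp_perfect)
    show "connected (sphere (0::complex) 1)" by (rule connected_sphere) simp
    show "sphere (0::complex) 1 \<noteq> {x}" for x
    proof
      assume "sphere (0::complex) 1 = {x}"
      moreover have "(1::complex) \<in> sphere 0 1" "(-1::complex) \<in> sphere 0 1" by auto
      ultimately have "(1::complex) = -1" by (metis singletonD)
      then show False by simp
    qed
  qed auto
  moreover have "connected (- {0::complex})"
    by (rule connected_punctured_universe) simp
  ultimately have "P w - Q w = 0"
    using analytic_continuation[of "\<lambda>z. P z - Q z" "-{0}" "sphere 0 1" 1 w] assms
      holomorphic_on_diff[OF assms(1,2)]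
    by auto
  then show ?thesis by simp
qed

text \<open>The description in \<open>ring_ext\<close> is unambiguous because any two expansions of
  \<open>F\<close> restrict to the same function on the unit circle through \<open>g\<close>, and
  both extend holomorphically to the punctured plane. This replaces an appeal to linear independence
  of characters.\<close>

lemma ring_ext_eq:
  fixes F :: "complex^'n \<Rightarrow> complex" and m :: "((real^'n) \<Rightarrow>\<^sub>L real) \<Rightarrow> int"
  assumes A: "finite A" "A \<subseteq> weight_lattice"
    and F: "\<And>h. h \<in> carrier torus \<Longrightarrow> F h = (\<Sum>a\<in>A. of_int (m a) * torus_char a h)"
    and \<xi>: "\<xi> \<in> torus_lattice" and g: "g \<in> carrier torus" and z: "z \<noteq> 0"
  shows "ring_ext \<xi> F g z = (\<Sum>a\<in>A. of_int (m a) * char_ext \<xi> a g z)"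
  unfolding ring_ext_def
proof (rule the_equality)
  fix y
  assume "\<exists>B (k :: ((real^'n) \<Rightarrow>\<^sub>L real) \<Rightarrow> int). finite B \<and> B \<subseteq> weight_lattice \<and>
     (\<forall>h\<in>carrier torus. F h = (\<Sum>a\<in>B. of_int (k a) * torus_char a h)) \<and>
     y = (\<Sum>a\<in>B. of_int (k a) * char_ext \<xi> a g z)"
  then obtain B k where B: "finite B" "B \<subseteq> weight_lattice"
    "\<And>h. h \<in> carrier torus \<Longrightarrow> F h = (\<Sum>a\<in>B. of_int (k a) * torus_char a h)"
    and y: "y = (\<Sum>a\<in>B. of_int (k a) * char_ext \<xi> a g z)" by blast
  have on_circle: "(\<Sum>a\<in>C. of_int (j a) * char_ext \<xi> a g w) = F (g * circle_param \<xi> w)"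
    if "C \<subseteq> weight_lattice" "\<And>h. h \<in> carrier torus \<Longrightarrow> F h = (\<Sum>a\<in>C. of_int (j a) * torus_char a h)"
      "norm w = 1" for C w and j :: "((real^'n) \<Rightarrow>\<^sub>L real) \<Rightarrow> int"
  proof -
    have "F (g * circle_param \<xi> w) = (\<Sum>a\<in>C. of_int (j a) * torus_char a (g * circle_param \<xi> w))"
      by (intro that(2) torus_mult_closed g circle_param_in_carrier that(3))
    also have "\<dots> = (\<Sum>a\<in>C. of_int (j a) * char_ext \<xi> a g w)"
      by (intro sum.cong refl arg_cong2[of _ _ _ _ "(*)"] torus_char_circle_param \<xi> g that(3))
         (use that(1) in auto)
    finally show ?thesis by simp
  qed
  show "y = (\<Sum>a\<in>A. of_int (m a) * char_ext \<xi> a g z)"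
    unfolding y
  proof (rule holomorphic_eq_off_zero[OF _ _ _ z])
    show "(\<Sum>a\<in>B. of_int (k a) * char_ext \<xi> a g w) = (\<Sum>a\<in>A. of_int (m a) * char_ext \<xi> a g w)"
      if "norm w = 1" for w
      using on_circle[OF B(2,3) that] on_circle[OF A(2) F that] by simp
  qed (auto intro!: holomorphic_intros holomorphic_on_char_ext)
qed (use A F in blast)

text \<open>An injective parametrisation \<open>h\<close> of \<open>T\<close> has the form
  \<open>s \<mapsto> torus_exp (s \<eta>)\<close> with \<eta> in the lattice of \<open>T\<close>, so
  \<eta> is an integer multiple of \<xi>. The multiple is nonzero, hence \<xi> and \<eta> span the
  same line and have the same image under the exponential map. Injectivity in terms of \<xi> comes
  from \<xi> generating the whole lattice.\<close>

lemma circle_subgroup_eq: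
  fixes T :: "(complex^'n) set" and \<xi> :: "real^'n"
  assumes T: "circle_subgroup T" and \<xi>: "infinitesimal_generator T \<xi>"
  shows "\<xi> \<in> torus_lattice" "inj_on (circle_param \<xi>) (sphere 0 1)"
    "T = circle_param \<xi> ` sphere 0 1"
proof -
  have gen: "{v \<in> lie_algebra T. torus_exp v = 1} = range (\<lambda>k::int. of_int k *\<^sub>R \<xi>)"
    and "\<xi> \<noteq> 0"
    using \<xi> by (auto simp: infinitesimal_generator_def)
  have \<xi>_lie: "\<xi> \<in> lie_algebra T" and exp_\<xi>: "torus_exp \<xi> = 1"
    using gen rangeI[of "\<lambda>k::int. of_int k *\<^sub>R \<xi>" 1] by auto
  from exp_\<xi> show lat: "\<xi> \<in> torus_lattice"
    by (simp add: torus_lattice_def)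
  have exp_eq_1: "s \<in> \<int>" if "torus_exp (s *\<^sub>R \<xi>) = 1" for s
  proof -
    have "s *\<^sub>R \<xi> \<in> lie_algebra T"
      using \<xi>_lie by (auto simp: lie_algebra_def)
    then have "s *\<^sub>R \<xi> \<in> range (\<lambda>k::int. of_int k *\<^sub>R \<xi>)"
      unfolding gen[symmetric] using that by simp
    then obtain k :: int where "s *\<^sub>R \<xi> = of_int k *\<^sub>R \<xi>" by (rule rangeE)
    with \<open>\<xi> \<noteq> 0\<close> show ?thesis by simp
  qed
  show "inj_on (circle_param \<xi>) (sphere 0 1)"
  proof (rule inj_onI)
    fix z w :: complex assume zw: "z \<in> sphere 0 1" "w \<in> sphere 0 1" "circle_param \<xi> z = circle_param \<xi> w"
    obtain s where s: "z = cis (2 * pi * s)" using zw(1) by (auto intro: unit_complex_cis)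
    obtain t where t: "w = cis (2 * pi * t)" using zw(2) by (auto intro: unit_complex_cis)
    have "torus_exp (t *\<^sub>R \<xi>) * torus_exp ((s - t) *\<^sub>R \<xi>) = torus_exp (t *\<^sub>R \<xi>) * 1"
      using zw(3) by (simp add: s t circle_param_cis[OF lat] flip: torus_exp_add scaleR_left_distrib)
    then have "torus_exp ((s - t) *\<^sub>R \<xi>) = 1"
      by (simp only: torus_mult_cancel_left[OF torus_exp_in_carrier])
    from exp_eq_1[OF this] have "cis (2 * pi * (s - t)) = 1"
      by simp
    then show "z = w"
      by (simp add: s t right_diff_distrib flip: cis_divide)
  qed
  obtain h where h: "h \<in> hom circle_group torus" "inj_on h (carrier circle_group)"
    "continuous_on (carrier circle_group) h" "T = h ` carrier circle_group"
    using T by (auto simp: circle_subgroup_def)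
  have h_mult: "h (z * w) = h z * h w" and h_carrier: "h z \<in> carrier torus"
    if "norm z = 1" "norm w = 1" for z w
    using h(1) that unfolding hom_def by auto
  have "\<exists>c. \<forall>s. h (cis (2 * pi * s)) $ i = cis (2 * pi * (c * s))" for i
  proof -
    have "continuous_on UNIV (\<lambda>s. h (cis (2 * pi * s)))"
      by (rule continuous_on_compose2[OF h(3)]) (auto simp: cis_conv_exp intro!: continuous_intros)
    then have "continuous_on UNIV (\<lambda>s. h (cis (2 * pi * s)) $ i)"
      by (intro continuous_intros)
    then show ?thesis
    proof (rule continuous_real_character)
      show "h (cis (2 * pi * (x + y))) $ i = h (cis (2 * pi * x)) $ i * h (cis (2 * pi * y)) $ i" for x y
        by (simp add: distrib_left flip: cis_mult) (simp add: h_mult)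
      show "norm (h (cis (2 * pi * x)) $ i) = 1" for x
        using h_carrier[of "cis (2 * pi * x)" 1] by (simp add: carrier_torus)
    qed blast
  qed
  then obtain c where c: "h (cis (2 * pi * s)) $ i = cis (2 * pi * (c i * s))" for i s
    by metis
  define \<eta> :: "real^'n" where "\<eta> = (\<chi> i. c i)"
  have h_eq: "h (cis (2 * pi * s)) = torus_exp (s *\<^sub>R \<eta>)" for s
    by (simp add: cart_eq_iff c \<eta>_def mult.commute[of s])
  have T_eq: "T = range (\<lambda>s. torus_exp (s *\<^sub>R \<eta>))"
  proof -
    have "carrier circle_group = range (\<lambda>s. cis (2 * pi * s))"
      unfolding range_cis by auto
    then show ?thesis by (simp add: h(4) image_image h_eq)
  qed
  have "torus_exp \<eta> = 1"
  proof -
    have "torus_exp \<eta> = h 1" using h_eq[of 1] by simp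
    also have "h 1 = 1" using h_eq[of 0] by simp
    finally show ?thesis .
  qed
  moreover have "\<eta> \<in> lie_algebra T"
    by (auto simp: lie_algebra_def T_eq)
  ultimately have "\<eta> \<in> range (\<lambda>k::int. of_int k *\<^sub>R \<xi>)"
    unfolding gen[symmetric] by simp
  then obtain m :: int where m: "\<eta> = of_int m *\<^sub>R \<xi>" by (rule rangeE)
  \<comment> \<open>Otherwise \<open>h\<close> would be constant; comparing a half turn with no turn
    contradicts injectivity.\<close>
  have "m \<noteq> 0"
  proof
    assume "m = 0"
    then have "h (cis (2 * pi * (1/2))) = h (cis (2 * pi * 0))"
      unfolding h_eq by (simp add: m)
    then have "cis (2 * pi * (1/2)) = cis (2 * pi * 0)"
      by (rule inj_onD[OF h(2)]) auto
    then show False by simp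
  qed
  have "T = range (\<lambda>s. torus_exp (s *\<^sub>R \<xi>))"
  proof (intro equalityI subsetI)
    fix x assume "x \<in> range (\<lambda>s. torus_exp (s *\<^sub>R \<xi>))"
    then obtain s where "x = torus_exp (s *\<^sub>R \<xi>)" by blast
    then have "x = torus_exp ((s / of_int m) *\<^sub>R \<eta>)"
      using \<open>m \<noteq> 0\<close> by (simp add: m)
    then show "x \<in> T" by (auto simp: T_eq)
  next
    fix x assume "x \<in> T"
    then show "x \<in> range (\<lambda>s. torus_exp (s *\<^sub>R \<xi>))" by (auto simp: T_eq m)
  qed
  also have "\<dots> = circle_param \<xi> ` range (\<lambda>s. cis (2 * pi * s))"
    by (simp add: image_image circle_param_cis[OF lat])
  also have "range (\<lambda>s. cis (2 * pi * s)) = sphere 0 1"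
    by (rule range_cis)
  finally show "T = circle_param \<xi> ` sphere 0 1" .
qed

section \<open>Isotropy representations\<close>

lemma diag_block_mat_1x1:
  assumes "\<forall>A\<in>set As. A \<in> carrier_mat 1 1"
  shows "diag_block_mat As =
    mat (length As) (length As) (\<lambda>(i, j). if i = j then (As ! i) $$ (0, 0) else 0)"
  using assms
proof (induction As)
  case (Cons A As)
  then have A: "A \<in> carrier_mat 1 1" by simp
  show ?case
    using A Cons by (intro eq_matI) (auto simp: Let_def nth_Cons split: nat.splits)
qed auto

lemma char_poly_diag_block_1x1:
  assumes "\<forall>A\<in>set As. A \<in> carrier_mat 1 1"
  shows "char_poly (diag_block_mat As) = (\<Prod>A\<leftarrow>As. [:- (A $$ (0, 0)), 1:])"
proof -
  let ?D = "diag_block_mat As"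
  have D: "?D \<in> carrier_mat (length As) (length As)" "upper_triangular ?D"
    using diag_block_mat_1x1[OF assms] by (auto simp: upper_triangular_def)
  have "diag_mat ?D = map (\<lambda>A. A $$ (0, 0)) As"
    unfolding diag_block_mat_1x1[OF assms] diag_mat_def by (rule nth_equalityI) auto
  then show ?thesis
    by (simp add: char_poly_upper_triangular[OF D] comp_def)
qed

text \<open>An intertwining matrix is a conjugation at each group element. The characteristic
  polynomial is the invariant kept here because it records all eigenvalues with
  multiplicity.\<close>

lemma rep_iso_char_poly:
  assumes iso: "rep_iso H k \<rho> \<sigma>" and g: "g \<in> H"
    and c: "\<rho> g \<in> carrier_mat k k" "\<sigma> g \<in> carrier_mat k k"
  shows "char_poly (\<rho> g) = char_poly (\<sigma> g)"
proof -
  obtain P where P: "P \<in> carrier_mat k k" "invertible_mat P" "P * \<rho> g = \<sigma> g * P"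
    using iso g by (auto simp: rep_iso_def)
  from P(2) obtain Q where Q: "P * Q = 1\<^sub>m k" "Q * P = 1\<^sub>m (dim_row Q)"
    using P(1) by (auto simp: invertible_mat_def inverts_mat_def)
  have Qc: "Q \<in> carrier_mat k k"
    using arg_cong[OF Q(1), of dim_col] arg_cong[OF Q(2), of dim_col] P(1)
    by (auto intro!: carrier_matI)
  have "P * \<rho> g * Q = \<sigma> g * P * Q" using P(3) by simp
  also have "\<dots> = \<sigma> g * (P * Q)" using P Qc c by (simp add: assoc_mult_mat[of _ k k _ k _ k])
  also have "\<dots> = \<sigma> g" using c Q(1) by simp
  finally have "similar_mat_wit (\<sigma> g) (\<rho> g) P Q"
    using P Qc c Q by (auto simp: similar_mat_wit_def Let_def)
  then have "similar_mat (\<sigma> g) (\<rho> g)" by (auto simp: similar_mat_def)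
  from char_poly_similar[OF this] show ?thesis by simp
qed

context graph_action
begin

lemma edge_matrix:
  assumes "e \<in> arcs \<Gamma>" "g \<in> carrier torus"
  shows "\<rho> e g \<in> carrier_mat 1 1" "\<rho> e g $$ (0, 0) = torus_char (\<alpha> e) g"
  using rep_edge[OF assms(1)] char_edge[OF assms] assms(2)
  by (auto simp: representation_def rep_char_def)

text \<open>The values of the isotropy characters are the eigenvalues of \<open>\<tau> p g\<close>.
  The count of outgoing edges makes the block sum a d by d matrix, so that it can be compared with
  \<open>\<tau> p g\<close>.\<close>

lemma char_poly_vertex:
  assumes "p \<in> verts \<Gamma>" "g \<in> carrier torus" "card (out_arcs \<Gamma> p) = d"
  shows "char_poly (\<tau> p g) = (\<Prod>e\<in>out_arcs \<Gamma> p. [:- torus_char (\<alpha> e) g, 1:])"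
proof -
  obtain es where es: "distinct es" "set es = out_arcs \<Gamma> p"
    "rep_iso (carrier torus) d (\<tau> p) (rep_sum (map \<rho> es))"
    using vertex_decomp[OF assms(1)] by blast
  let ?As = "map (\<lambda>e. \<rho> e g) es"
  have sum: "rep_sum (map \<rho> es) g = diag_block_mat ?As"
    by (simp add: rep_sum_def comp_def)
  have As: "\<forall>A\<in>set ?As. A \<in> carrier_mat 1 1"
    using edge_matrix(1) es(2) assms(2) by auto
  have "length es = d"
    using es(1,2) assms(3) distinct_card by fastforce
  then have "rep_sum (map \<rho> es) g \<in> carrier_mat d d"
    unfolding sum diag_block_mat_1x1[OF As] by auto
  moreover have "\<tau> p g \<in> carrier_mat d d"
    using rep_vertex[OF assms(1)] assms(2) by (simp add: representation_def)
  ultimately have "char_poly (\<tau> p g) = char_poly (diag_block_mat ?As)"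
    using rep_iso_char_poly[OF es(3) assms(2)] sum by simp
  also have "\<dots> = (\<Prod>e\<leftarrow>es. [:- (\<rho> e g $$ (0, 0)), 1:])"
    by (simp add: char_poly_diag_block_1x1[OF As] comp_def)
  also have "\<dots> = (\<Prod>e\<in>out_arcs \<Gamma> p. [:- (\<rho> e g $$ (0, 0)), 1:])"
    by (simp add: es(2)[symmetric] prod.distinct_set_conv_list[OF es(1)])
  also have "\<dots> = (\<Prod>e\<in>out_arcs \<Gamma> p. [:- torus_char (\<alpha> e) g, 1:])"
    by (intro prod.cong refl) (use edge_matrix(2) assms(2) in auto)
  finally show ?thesis .
qed

text \<open>A 1 by 1 matrix can be read off from its characteristic polynomial, so isomorphic
  one-dimensional representations have equal entries; passing to the dual inverts the group
  element.\<close>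

lemma torus_char_reverse:
  assumes e: "e \<in> arcs \<Gamma>" "bar e \<in> arcs \<Gamma>" and g: "g \<in> carrier torus"
  shows "torus_char (\<alpha> (bar e)) g = inverse (torus_char (\<alpha> e) g)"
proof -
  let ?i = "inv\<^bsub>torus\<^esub> g"
  have i: "?i \<in> carrier torus" using g by simp
  have "char_poly (\<rho> (bar e) g) = char_poly (rep_dual (\<rho> e) g)"
    using edge_matrix(1) e g i by (intro rep_iso_char_poly[OF edge_reverse[OF e(1)]]) (auto simp: rep_dual_def)
  moreover have "char_poly A = [:- (A $$ (0, 0)), 1:]" if "A \<in> carrier_mat 1 1" for A :: "complex mat"
    using char_poly_diag_block_1x1[of "[A]", unfolded diag_block_mat_singleton] that by simp
  ultimately have "\<rho> (bar e) g $$ (0, 0) = rep_dual (\<rho> e) g $$ (0, 0)"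
    using edge_matrix(1)[OF e(2) g] edge_matrix(1)[OF e(1) i] by (simp add: rep_dual_def)
  then have "torus_char (\<alpha> (bar e)) g = torus_char (\<alpha> e) ?i"
    using edge_matrix[OF e(2) g] edge_matrix[OF e(1) i] by (simp add: rep_dual_def)
  moreover have "torus_char (\<alpha> e) g * torus_char (\<alpha> e) ?i = 1"
    using torus_char_mult[OF weight_edge[OF e(1)] g i] torus.r_inv[OF g] weight_edge[OF e(1)] by simp
  ultimately show ?thesis by (simp add: inverse_unique)
qed

text \<open>On the kernel of an edge character the two isotropy representations have equal characteristic
  polynomials; both contain the factor \<open>X - 1\<close> coming from the edge itself, which cancels.\<close>

lemma prod_edge_compat:
  assumes e: "e \<in> arcs \<Gamma>" "bar e \<in> arcs \<Gamma>" "tail \<Gamma> (bar e) = head \<Gamma> e"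
    and v: "tail \<Gamma> e \<in> verts \<Gamma>" "head \<Gamma> e \<in> verts \<Gamma>"
    and val: "valent \<Gamma> d" and fin: "finite (arcs \<Gamma>)" and g: "g \<in> char_ker (\<alpha> e)"
  shows "(\<Prod>e'\<in>out_arcs \<Gamma> (tail \<Gamma> e) - {e}. 1 - torus_char (\<alpha> e') g) =
    (\<Prod>e'\<in>out_arcs \<Gamma> (head \<Gamma> e) - {bar e}. 1 - torus_char (\<alpha> e') g)"
proof -
  have gt: "g \<in> carrier torus" and g1: "torus_char (\<alpha> e) g = 1"
    using g by (auto simp: mem_char_ker)
  then have g2: "torus_char (\<alpha> (bar e)) g = 1"
    using torus_char_reverse[OF e(1,2)] by simp
  have fin_out: "finite (out_arcs \<Gamma> p)" for p
    using fin by (rule finite_subset[rotated]) auto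
  let ?f = "\<lambda>e'. [:- torus_char (\<alpha> e') g, 1:]"
  have "char_poly (\<tau> (tail \<Gamma> e) g) = char_poly (\<tau> (head \<Gamma> e) g)"
    using rep_vertex[OF v(1)] rep_vertex[OF v(2)] gt
    by (intro rep_iso_char_poly[OF edge_compat[OF e(1)] g]) (auto simp: representation_def)
  then have "prod ?f (out_arcs \<Gamma> (tail \<Gamma> e)) = prod ?f (out_arcs \<Gamma> (head \<Gamma> e))"
    using char_poly_vertex v gt val by (simp add: valent_def)
  moreover have "prod ?f (out_arcs \<Gamma> (tail \<Gamma> e)) = [:-1, 1:] * prod ?f (out_arcs \<Gamma> (tail \<Gamma> e) - {e})"
    using e g1 by (subst prod.remove[OF fin_out, of e]) auto
  moreover have "prod ?f (out_arcs \<Gamma> (head \<Gamma> e)) = [:-1, 1:] * prod ?f (out_arcs \<Gamma> (head \<Gamma> e) - {bar e})"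
    using e g2 by (subst prod.remove[OF fin_out, of "bar e"]) auto
  ultimately have "[:-1, 1:] * prod ?f (out_arcs \<Gamma> (tail \<Gamma> e) - {e}) =
      [:-1, 1:] * prod ?f (out_arcs \<Gamma> (head \<Gamma> e) - {bar e})"
    by simp
  then have "prod ?f (out_arcs \<Gamma> (tail \<Gamma> e) - {e}) = prod ?f (out_arcs \<Gamma> (head \<Gamma> e) - {bar e})"
    by (simp only: mult_cancel_left) simp
  \<comment> \<open>At \<open>X = 1\<close> a factor \<open>X - \<chi>\<close> becomes
    \<open>1 - \<chi>\<close>. Evaluation has to follow the cancellation, since the common factor
    \<open>X - 1\<close> vanishes there; this is why the comparison runs through
    polynomials.\<close>
  from arg_cong[OF this, of "\<lambda>p. poly p 1"] show ?thesis
    by (simp add: poly_prod)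
qed

end

section \<open>The roots of an edge character on a coset of the circle, and the push-forward\<close>

definition unit_roots :: "complex \<Rightarrow> int \<Rightarrow> complex set" where
  "unit_roots c k = {z. norm z = 1 \<and> c * z powi k = 1}"

lemma real_powi_eq_1:
  fixes x :: real
  assumes "x \<ge> 0" "k \<noteq> 0" "x powi k = 1" shows "x = 1"
proof -
  have *: "x = 1" if "x ^ n = 1" "n > 0" for n
    using that assms(1) power_eq_iff_eq_base[of n x 1] by simp
  show ?thesis
    using assms(2,3) * by (cases k rule: int_cases2) (auto simp: power_int_minus)
qed

text \<open>Taking norms gives \<open>norm z powi k = 1\<close>, so every solution in the plane lies
  on the unit circle. Hence the denominators have no zeros elsewhere.\<close>

lemma unit_rootsI:
  assumes "norm c = 1" "k \<noteq> 0" "c * z powi k = 1" shows "z \<in> unit_roots c k"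
proof -
  have "norm z powi k = 1"
    using arg_cong[OF assms(3), of norm] assms(1) by (simp add: norm_mult norm_power_int)
  with assms show ?thesis by (auto simp: unit_roots_def intro: real_powi_eq_1)
qed

lemma card_unit_roots:
  assumes "norm c = 1" "k \<noteq> 0"
  shows "finite (unit_roots c k)" "card (unit_roots c k) = nat \<bar>k\<bar>"
proof -
  have "c \<noteq> 0" using assms(1) by auto
  then have c1: "c * y = 1 \<longleftrightarrow> y = inverse c" and c2: "c * inverse y = 1 \<longleftrightarrow> y = c" for y
    by (auto simp: field_simps)
  \<comment> \<open>Both signs of \<open>k\<close> reduce to a positive power: \<open>b\<close> is
    \<open>inverse c\<close> for positive \<open>k\<close> and \<open>c\<close> itself for negative
    \<open>k\<close>.\<close>
  obtain n b where n: "n > 0" "n = nat \<bar>k\<bar>" "b \<noteq> 0" and b: "\<And>z. c * z powi k = 1 \<longleftrightarrow> z ^ n = b"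
  proof (cases "k > 0")
    case True
    show ?thesis
    proof (rule that[of "nat k" "inverse c"])
      show "c * z powi k = 1 \<longleftrightarrow> z ^ nat k = inverse c" for z
        using True by (simp add: power_int_def c1)
    qed (use True assms in auto)
  next
    case False
    show ?thesis
    proof (rule that[of "nat (-k)" c])
      show "c * z powi k = 1 \<longleftrightarrow> z ^ nat (-k) = c" for z
        using False assms(2) by (simp add: power_int_def power_inverse c2)
    qed (use False assms in auto)
  qed
  have "unit_roots c k = {z. z ^ n = b}"
    using unit_rootsI[OF assms] b by (auto simp: unit_roots_def)
  then show "finite (unit_roots c k)" "card (unit_roots c k) = nat \<bar>k\<bar>"
    using n finite_nth_roots card_nth_roots by auto
qed

text \<open>Here \<open>g\<close> is any point of the coset, not necessarily in the kernel. The
  roots are the circle elements that move \<open>g\<close> into the kernel, and \<open>W\<close>,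
  the kernel intersected with \<open>T\<close>, consists of the roots for \<open>g = 1\<close>. The
  preimage chosen in the definition is \<open>g\<close> moved by some root \<open>z0\<close>, and
  multiplication by \<open>z0\<close> carries \<open>W\<close> to the roots of
  \<open>g\<close>.\<close>

lemma push_forward_eq:
  fixes T :: "(complex^'n) set"
  assumes \<xi>: "\<xi> \<in> torus_lattice" and inj: "inj_on (circle_param \<xi>) (sphere 0 1)"
    and T: "T = circle_param \<xi> ` sphere 0 1"
    and a: "a \<in> weight_lattice" and k: "\<lfloor>blinfun_apply a \<xi>\<rfloor> = k" "k \<noteq> 0" and g: "g \<in> carrier torus"
  shows "push_forward T (char_ker a) h (T #>\<^bsub>torus\<^esub> g) =
    1 / of_int \<bar>k\<bar> * (\<Sum>z\<in>unit_roots (torus_char a g) k. h (g * circle_param \<xi> z))"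
proof -
  let ?Z = "unit_roots (torus_char a g) k" and ?cp = "circle_param \<xi>"
  have coset: "T #>\<^bsub>torus\<^esub> g = (\<lambda>z. g * ?cp z) ` sphere 0 1"
    by (auto simp: r_coset_def T mult.commute)
  have ker: "g' * ?cp z \<in> char_ker a \<longleftrightarrow> z \<in> unit_roots (torus_char a g') k"
    if "norm z = 1" "g' \<in> carrier torus" for g' z
    using that torus_char_circle_param[OF a \<xi> that(2,1)]
    by (simp add: mem_char_ker torus_mult_closed circle_param_in_carrier char_ext_def k(1) unit_roots_def)
  define x where "x = (SOME x. x \<in> char_ker a \<and> T #>\<^bsub>torus\<^esub> x = T #>\<^bsub>torus\<^esub> g)"
  have coset_eq: "T #>\<^bsub>torus\<^esub> (g * ?cp z) = T #>\<^bsub>torus\<^esub> g" if "norm z = 1" for z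
  proof -
    have "z * u \<in> sphere 0 1" "u / z \<in> sphere 0 1" "z * (u / z) = u" if "u \<in> sphere 0 1" for u
      using that \<open>norm z = 1\<close> by (auto simp: norm_mult norm_divide)
    then have "(\<lambda>u. z * u) ` sphere 0 1 = sphere 0 1"
      by (metis (no_types, lifting) image_eqI image_subset_iff subsetI subset_antisym)
    then have "(\<lambda>u. g * ?cp u) ` sphere 0 1 = (\<lambda>u. g * ?cp (z * u)) ` sphere 0 1"
      by (metis (no_types, lifting) image_image image_cong)
    moreover have "T #>\<^bsub>torus\<^esub> (g * ?cp z) = (\<lambda>u. g * ?cp (z * u)) ` sphere 0 1"
      by (auto simp: r_coset_def T circle_param_mult mult_ac)
    ultimately show ?thesis by (simp add: coset)
  qed
  have "card ?Z \<noteq> 0" using card_unit_roots[of "torus_char a g" k] k(2) by simp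
  then obtain z1 where "z1 \<in> ?Z" by (metis card.empty ex_in_conv)
  then have "g * ?cp z1 \<in> char_ker a" "norm z1 = 1"
    using ker g by (auto simp: unit_roots_def)
  then have x: "x \<in> char_ker a" "T #>\<^bsub>torus\<^esub> x = T #>\<^bsub>torus\<^esub> g"
    using someI_ex[of "\<lambda>x. x \<in> char_ker a \<and> T #>\<^bsub>torus\<^esub> x = T #>\<^bsub>torus\<^esub> g"] coset_eq
    unfolding x_def by blast+
  have "?cp 1 = 1" by (simp add: circle_param_def cart_eq_iff)
  \<comment> \<open>Since \<open>T\<close> contains 1, the chosen preimage lies in its own coset,
    which is the coset of \<open>g\<close>; this yields \<open>z0\<close>.\<close>
  then have "x \<in> T #>\<^bsub>torus\<^esub> x"
    unfolding r_coset_def T by (auto intro!: bexI[of _ 1])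
  then obtain z0 where z0: "norm z0 = 1" "x = g * ?cp z0"
    using x(2) coset by auto
  then have z0Z: "z0 \<in> ?Z" using x(1) ker g by simp
  have W: "char_ker a \<inter> T = ?cp ` unit_roots 1 k"
    using ker[of _ 1] a torus.one_closed by (auto simp: T unit_roots_def)
  have injW: "inj_on ?cp (unit_roots 1 k)"
    by (rule inj_on_subset[OF inj]) (auto simp: unit_roots_def)
  have bij: "bij_betw (\<lambda>w. z0 * w) (unit_roots 1 k) ?Z"
  proof (rule bij_betwI[where g = "\<lambda>w. w / z0"])
    show "(\<lambda>w. w / z0) \<in> ?Z \<rightarrow> unit_roots 1 k"
    proof
      fix w assume w: "w \<in> ?Z"
      then have "torus_char a g * w powi k = torus_char a g * z0 powi k"
        using z0Z by (simp add: unit_roots_def)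
      then have "w powi k = z0 powi k" by simp
      then show "w / z0 \<in> unit_roots 1 k"
        using w z0(1) by (auto simp: unit_roots_def norm_divide power_int_divide_distrib)
    qed
  qed (use z0Z in \<open>auto simp: unit_roots_def norm_mult power_int_mult_distrib\<close>)
  have "(\<Sum>w\<in>char_ker a \<inter> T. h (x \<otimes>\<^bsub>torus\<^esub> w)) = (\<Sum>w\<in>unit_roots 1 k. h (g * ?cp (z0 * w)))"
    by (simp add: W sum.reindex[OF injW] z0(2) circle_param_mult mult.assoc)
  also have "\<dots> = (\<Sum>z\<in>?Z. h (g * ?cp z))"
    by (rule sum.reindex_bij_betw[OF bij])
  finally have sum: "(\<Sum>w\<in>char_ker a \<inter> T. h (x \<otimes>\<^bsub>torus\<^esub> w)) = (\<Sum>z\<in>?Z. h (g * ?cp z))" .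
  have "card (char_ker a \<inter> T) = nat \<bar>k\<bar>"
    using card_unit_roots[of 1 k] k(2) by (simp add: W card_image[OF injW])
  then have "complex_of_nat (card (char_ker a \<inter> T)) = of_int \<bar>k\<bar>"
    by simp
  then show ?thesis
    unfolding push_forward_def Let_def x_def[symmetric] sum by simp
qed

section \<open>Residues at simple poles on the unit circle\<close>

text \<open>The derivative of \<open>1 - c * w powi k\<close> at a root is \<open>- k / z0\<close>;
  its factor \<open>1 / z0\<close> cancels against the one from \<open>1 / w\<close>, leaving a
  weight that depends on \<open>k\<close> alone.\<close>

lemma residue_simple_factor:
  fixes c :: complex
  assumes z0: "z0 \<in> unit_roots c k" and k: "k \<noteq> 0"
    and S: "open S" "z0 \<in> S" and holo: "(\<lambda>w. Q w * inverse (1 - c * w powi k) / w) holomorphic_on S - {z0}"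
    and cont: "isCont Q z0"
  shows "residue (\<lambda>w. Q w * inverse (1 - c * w powi k) / w) z0 = - (1 / of_int k) * Q z0"
proof (rule residue_simple'[OF S holo])
  have nz: "z0 \<noteq> 0" and root: "c * z0 powi k = 1"
    using z0 by (auto simp: unit_roots_def)
  have "((\<lambda>w. 1 - c * w powi k) has_field_derivative (- of_int k / z0)) (at z0)"
    using nz root
    by (auto intro!: derivative_eq_intros simp: power_int_diff field_simps)
  then have "((\<lambda>w. (1 - c * w powi k) / (w - z0)) \<longlongrightarrow> - of_int k / z0) (at z0)"
    by (simp add: has_field_derivative_iff root)
  then have "((\<lambda>w. inverse ((1 - c * w powi k) / (w - z0))) \<longlongrightarrow> inverse (- of_int k / z0)) (at z0)"
    by (rule tendsto_inverse) (use k nz in simp)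
  moreover have "((\<lambda>w. Q w / w) \<longlongrightarrow> Q z0 / z0) (at z0)"
    using cont nz by (intro tendsto_intros) (auto simp: isCont_def)
  ultimately have "((\<lambda>w. Q w / w * inverse ((1 - c * w powi k) / (w - z0))) \<longlongrightarrow>
      Q z0 / z0 * inverse (- of_int k / z0)) (at z0)"
    by (rule tendsto_mult[rotated])
  then show "((\<lambda>w. Q w * inverse (1 - c * w powi k) / w * (w - z0)) \<longlongrightarrow>
      - (1 / of_int k) * Q z0) (at z0)"
    using nz by (simp add: field_simps)
qed

text \<open>The residue at 0 enters both integrals with winding number 1 and drops out, so nothing
  about the order of the pole there is required. Disjointness of the root sets makes the remaining
  poles simple and lets their sum be split by the factor that vanishes.\<close>

lemma circle_residue_difference:
  fixes c :: "'e \<Rightarrow> complex" and k :: "'e \<Rightarrow> int"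
  assumes I: "finite I" and P: "P holomorphic_on -{0}"
    and c: "\<And>e. e \<in> I \<Longrightarrow> norm (c e) = 1" and k: "\<And>e. e \<in> I \<Longrightarrow> k e \<noteq> 0"
    and disj: "\<And>e e'. e \<in> I \<Longrightarrow> e' \<in> I \<Longrightarrow> e \<noteq> e' \<Longrightarrow>
      unit_roots (c e) (k e) \<inter> unit_roots (c e') (k e') = {}"
    and r: "1 < r\<^sub>1" "0 < r\<^sub>2" "r\<^sub>2 < 1"
  defines "F \<equiv> \<lambda>z. P z * (\<Prod>e\<in>I. inverse (1 - c e * z powi k e))"
  shows "1 / (2 * of_real pi * \<i>) * contour_integral (circlepath 0 r\<^sub>1) (\<lambda>z. F z / z) -
      1 / (2 * of_real pi * \<i>) * contour_integral (circlepath 0 r\<^sub>2) (\<lambda>z. F z / z) =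
    (\<Sum>e\<in>I. - (1 / of_int (k e)) * (\<Sum>z\<in>unit_roots (c e) (k e).
       P z * (\<Prod>e'\<in>I - {e}. inverse (1 - c e' * z powi k e'))))"
proof -
  define Z where "Z e = unit_roots (c e) (k e)" for e
  define R where "R = (\<Union>e\<in>I. Z e)"
  have fin: "finite R"
    using I c k card_unit_roots(1) by (auto simp: R_def Z_def)
  have normR: "norm z = 1" if "z \<in> R" for z
    using that by (auto simp: R_def Z_def unit_roots_def)
  have nz: "1 - c e * z powi k e \<noteq> 0" if "e \<in> I" "z \<notin> Z e" for e z
    using that unit_rootsI[OF c[of e] k[of e], of z] by (auto simp: Z_def)
  have holo: "(\<lambda>z. F z / z) holomorphic_on UNIV - insert 0 R"
    unfolding F_def
    by (intro holomorphic_intros holomorphic_on_subset[OF P]) (use nz in \<open>auto simp: R_def\<close>)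
  have residue: "residue (\<lambda>z. F z / z) z0 =
      - (1 / of_int (k e)) * (P z0 * (\<Prod>e'\<in>I - {e}. inverse (1 - c e' * z0 powi k e')))"
    if e: "e \<in> I" "z0 \<in> Z e" for e z0
  proof -
    define Q where "Q z = P z * (\<Prod>e'\<in>I - {e}. inverse (1 - c e' * z powi k e'))" for z
    have F_eq: "F z / z = Q z * inverse (1 - c e * z powi k e) / z" for z
      using I e(1) by (simp add: F_def Q_def prod.remove[of I e] mult_ac)
    let ?S = "- insert 0 (R - {z0})"
    have z0: "z0 \<noteq> 0" using e by (auto simp: Z_def unit_roots_def)
    have "open ?S" using fin by (intro open_Compl finite_imp_closed) auto
    moreover have "z0 \<in> ?S" using z0 by simp
    moreover have "(\<lambda>z. Q z * inverse (1 - c e * z powi k e) / z) holomorphic_on ?S - {z0}"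
      unfolding F_eq[symmetric] by (rule holomorphic_on_subset[OF holo]) auto
    moreover have "isCont Q z0"
    proof -
      have "z0 \<notin> Z e'" if "e' \<in> I - {e}" for e'
        using disj[of e e'] that e by (auto simp: Z_def)
      moreover have "isCont P z0"
        using holomorphic_on_imp_continuous_on[OF P] z0
        by (simp add: continuous_on_eq_continuous_at open_Compl)
      ultimately show ?thesis
        unfolding Q_def by (intro continuous_intros) (use nz z0 in auto)
    qed
    ultimately show ?thesis
      unfolding F_eq[abs_def] Q_def[symmetric]
      using residue_simple_factor[OF e(2)[unfolded Z_def] k[OF e(1)]] by blast
  qed
  have zeroR: "0 \<notin> R" using normR[of 0] by auto
  have int1: "contour_integral (circlepath 0 r\<^sub>1) (\<lambda>z. F z / z) =
      2 * pi * \<i> * (\<Sum>z\<in>insert 0 R. residue (\<lambda>z. F z / z) z)"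
  proof -
    have "contour_integral (circlepath 0 r\<^sub>1) (\<lambda>z. F z / z) =
        2 * pi * \<i> * (\<Sum>z\<in>insert 0 R. winding_number (circlepath 0 r\<^sub>1) z * residue (\<lambda>z. F z / z) z)"
      using holo fin r normR by (intro Residue_theorem[where S = UNIV]) auto
    moreover have "winding_number (circlepath 0 r\<^sub>1) z = 1" if "z \<in> insert 0 R" for z
      using that normR[of z] r by (intro winding_number_circlepath) auto
    ultimately show ?thesis by simp
  qed
  have int2: "contour_integral (circlepath 0 r\<^sub>2) (\<lambda>z. F z / z) =
      2 * pi * \<i> * residue (\<lambda>z. F z / z) 0"
  proof -
    have "contour_integral (circlepath 0 r\<^sub>2) (\<lambda>z. F z / z) =
        2 * pi * \<i> * (\<Sum>z\<in>insert 0 R. winding_number (circlepath 0 r\<^sub>2) z * residue (\<lambda>z. F z / z) z)"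
      using holo fin r normR by (intro Residue_theorem[where S = UNIV]) auto
    moreover have "winding_number (circlepath 0 r\<^sub>2) z = 0" if "z \<in> R" for z
      using that normR[of z] r
      by (intro winding_number_zero_outside[of _ "cball 0 r\<^sub>2"]) auto
    moreover have "winding_number (circlepath 0 r\<^sub>2) 0 = 1"
      using r by (intro winding_number_circlepath) auto
    ultimately show ?thesis using fin zeroR by simp
  qed
  have "1 / (2 * of_real pi * \<i>) * contour_integral (circlepath 0 r\<^sub>1) (\<lambda>z. F z / z) -
      1 / (2 * of_real pi * \<i>) * contour_integral (circlepath 0 r\<^sub>2) (\<lambda>z. F z / z) =
      (\<Sum>z\<in>R. residue (\<lambda>z. F z / z) z)"
    unfolding int1 int2 using fin zeroR by (simp add: field_simps)
  also have "\<dots> = (\<Sum>e\<in>I. \<Sum>z\<in>Z e. residue (\<lambda>z. F z / z) z)"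
    unfolding R_def using I c k disj card_unit_roots(1)
    by (intro sum.UNION_disjoint) (auto simp: Z_def)
  also have "\<dots> = (\<Sum>e\<in>I. - (1 / of_int (k e)) * (\<Sum>z\<in>Z e.
       P z * (\<Prod>e'\<in>I - {e}. inverse (1 - c e' * z powi k e'))))"
    unfolding sum_distrib_left by (intro sum.cong refl residue)
  finally show ?thesis by (simp only: Z_def)
qed

lemma continuous_on_contour_integral_circlepath:
  assumes "continuous_on (U \<times> sphere 0 r) (\<lambda>(x, z). f x z)" and r: "r > 0"
  shows "continuous_on U (\<lambda>x. contour_integral (circlepath 0 r) (f x))"
proof -
  have "continuous_on U (\<lambda>x. integral (cbox 0 1)
      (\<lambda>t. f x (circlepath 0 r t) * vector_derivative (circlepath 0 r) (at t)))"
  proof (rule integral_continuous_on_param)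
    have "continuous_on (U \<times> cbox 0 1) ((\<lambda>(x, z). f x z) \<circ> (\<lambda>(x, t). (x, circlepath 0 r t)))"
    proof (rule continuous_on_compose)
      show "continuous_on (U \<times> cbox 0 1) (\<lambda>(x, t). (x, circlepath 0 r t))"
        unfolding circlepath case_prod_beta by (intro continuous_intros)
      show "continuous_on ((\<lambda>(x, t). (x, circlepath 0 r t)) ` (U \<times> cbox 0 1)) (\<lambda>(x, z). f x z)"
        using r by (intro continuous_on_subset[OF assms(1)])
          (auto simp: circlepath norm_mult)
    qed
    then show "continuous_on (U \<times> cbox 0 1)
        (\<lambda>(x, t). f x (circlepath 0 r t) * vector_derivative (circlepath 0 r) (at t))"
      unfolding vector_derivative_circlepath case_prod_beta comp_def fst_conv snd_conv
      by (intro continuous_intros)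
  qed
  then show ?thesis
    by (simp add: contour_integral_integral)
qed

section \<open>The residue formula at generic points\<close>

locale GKM_circle_action = fin_digraph \<Gamma> + bidirected_digraph \<Gamma> bar + GKM_action \<Gamma> bar d \<rho> \<alpha> \<tau>
  for \<Gamma> :: "('v, 'e) pre_digraph" and bar :: "'e \<Rightarrow> 'e" and d :: nat
    and \<rho> :: "'e \<Rightarrow> complex^'n \<Rightarrow> complex mat"
    and \<alpha> :: "'e \<Rightarrow> (real^'n) \<Rightarrow>\<^sub>L real"
    and \<tau> :: "'v \<Rightarrow> complex^'n \<Rightarrow> complex mat" +
  fixes T :: "(complex^'n) set" and \<xi> :: "real^'n" and \<phi> :: "'v \<Rightarrow> real"
  assumes val: "valent \<Gamma> d" and circle: "circle_subgroup T"
    and generator: "infinitesimal_generator T \<xi>" and moment: "moment_map \<Gamma> \<alpha> \<xi> \<phi>"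
begin

abbreviation deg :: "'e \<Rightarrow> int" where "deg e \<equiv> \<lfloor>blinfun_apply (\<alpha> e) \<xi>\<rfloor>"

abbreviation cp :: "complex \<Rightarrow> complex^'n" where "cp \<equiv> circle_param \<xi>"

abbreviation roots :: "'e \<Rightarrow> complex^'n \<Rightarrow> complex set" where
  "roots e g \<equiv> unit_roots (torus_char (\<alpha> e) g) (deg e)"

lemmas xi_lattice = circle_subgroup_eq(1)[OF circle generator]
  and inj_cp = circle_subgroup_eq(2)[OF circle generator]
  and T_eq = circle_subgroup_eq(3)[OF circle generator]

lemma deg_eq: "e \<in> arcs \<Gamma> \<Longrightarrow> of_int (deg e) = blinfun_apply (\<alpha> e) \<xi>"
  using weight_on_lattice[OF weight_edge xi_lattice] .

text \<open>A quotient with denominator 0 is 0 by convention, so positivity of the moment map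
  quotient forces \<open>deg e\<close> to be nonzero and to have the sign of the increase of \<phi>
  along the edge.\<close>

lemma deg_pos_iff:
  assumes "e \<in> arcs \<Gamma>"
  shows "deg e \<noteq> 0" "deg e > 0 \<longleftrightarrow> \<phi> (tail \<Gamma> e) < \<phi> (head \<Gamma> e)"
    "deg e < 0 \<longleftrightarrow> \<phi> (head \<Gamma> e) < \<phi> (tail \<Gamma> e)"
proof -
  have "(\<phi> (head \<Gamma> e) - \<phi> (tail \<Gamma> e)) / real_of_int (deg e) > 0"
    using moment assms by (simp add: moment_map_def deg_eq)
  then have *: "deg e > 0 \<and> \<phi> (tail \<Gamma> e) < \<phi> (head \<Gamma> e) \<or> deg e < 0 \<and> \<phi> (tail \<Gamma> e) > \<phi> (head \<Gamma> e)"
    by (simp only: zero_less_divide_iff of_int_0_less_iff of_int_less_0_iff diff_gt_0_iff_gt diff_less_0_iff_less) blast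
  then show "deg e \<noteq> 0" "deg e > 0 \<longleftrightarrow> \<phi> (tail \<Gamma> e) < \<phi> (head \<Gamma> e)"
    "deg e < 0 \<longleftrightarrow> \<phi> (head \<Gamma> e) < \<phi> (tail \<Gamma> e)" by linarith+
qed

text \<open>Both signs are read off from \<phi>, whose increase along an edge changes sign with the
  orientation.\<close>

lemma sgn_deg_bar: "e \<in> arcs \<Gamma> \<Longrightarrow> sgn (deg (bar e)) = - sgn (deg e)"
  using deg_pos_iff[of e] deg_pos_iff[of "bar e"]
  by (auto simp: sgn_if simp del: zero_less_floor floor_less_zero)

lemma mult_cp_in_carrier: "g \<in> carrier torus \<Longrightarrow> norm z = 1 \<Longrightarrow> g * cp z \<in> carrier torus"
  by (intro torus_mult_closed circle_param_in_carrier)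

lemma coset_eq: "T #>\<^bsub>torus\<^esub> g = (\<lambda>z. g * cp z) ` sphere 0 1"
  by (auto simp: r_coset_def T_eq mult.commute)

lemma roots_iff:
  assumes "e \<in> arcs \<Gamma>" "g \<in> carrier torus" "norm z = 1"
  shows "z \<in> roots e g \<longleftrightarrow> g * cp z \<in> char_ker (\<alpha> e)"
  using torus_char_circle_param[OF weight_edge[OF assms(1)] xi_lattice assms(2,3)] assms
  by (simp add: mem_char_ker mult_cp_in_carrier char_ext_def unit_roots_def)

text \<open>The index set is now the set of poles contributed by the edge, which makes the term
  directly comparable with a sum of residues.\<close>

lemma f_sharp_edge_eq:
  assumes e: "e \<in> arcs \<Gamma>" and g: "g \<in> carrier torus"
  shows "f_sharp_edge \<Gamma> \<alpha> T f e (T #>\<^bsub>torus\<^esub> g) =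
    1 / of_int \<bar>deg e\<bar> * (\<Sum>z\<in>roots e g. f_hat \<Gamma> \<alpha> f e (g * cp z))"
proof -
  have "g * cp z \<in> char_ker (\<alpha> e)" if "z \<in> roots e g" for z
    using that roots_iff[OF e g, of z] by (simp add: unit_roots_def)
  then have "(\<Sum>z\<in>roots e g. restrict (f_hat \<Gamma> \<alpha> f e) (char_ker (\<alpha> e)) (g * cp z)) =
      (\<Sum>z\<in>roots e g. f_hat \<Gamma> \<alpha> f e (g * cp z))"
    by (intro sum.cong) auto
  then show ?thesis
    unfolding f_sharp_edge_def
    using push_forward_eq[OF xi_lattice inj_cp T_eq weight_edge[OF e] refl deg_pos_iff(1)[OF e] g] by simp
qed

lemma char_ker_bar: "e \<in> arcs \<Gamma> \<Longrightarrow> char_ker (\<alpha> (bar e)) = char_ker (\<alpha> e)"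
  using torus_char_reverse[of e] by (auto simp: mem_char_ker)

lemma f_sharp_edge_bar:
  assumes e: "e \<in> arcs \<Gamma>" and f: "f \<in> K_ring \<Gamma> \<alpha>"
  shows "f_sharp_edge \<Gamma> \<alpha> T f (bar e) = f_sharp_edge \<Gamma> \<alpha> T f e"
proof -
  have "f_hat \<Gamma> \<alpha> f (bar e) g = f_hat \<Gamma> \<alpha> f e g" if g: "g \<in> char_ker (\<alpha> e)" for g
  proof -
    have "f (tail \<Gamma> e) g = f (head \<Gamma> e) g"
      using f e g unfolding K_ring_def by (auto dest!: bspec[of _ _ e] fun_cong[of _ _ g])
    moreover have "(\<Prod>e'\<in>out_arcs \<Gamma> (tail \<Gamma> e) - {e}. inverse (1 - torus_char (\<alpha> e') g)) =
        (\<Prod>e'\<in>out_arcs \<Gamma> (head \<Gamma> e) - {bar e}. inverse (1 - torus_char (\<alpha> e') g))"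
      using arg_cong[OF prod_edge_compat[of e g], of inverse] e g val
      by (simp add: prod_inversef[symmetric] comp_def)
    ultimately show ?thesis
      using e by (simp add: f_hat_def)
  qed
  then have "restrict (f_hat \<Gamma> \<alpha> f (bar e)) (char_ker (\<alpha> e)) = restrict (f_hat \<Gamma> \<alpha> f e) (char_ker (\<alpha> e))"
    by (rule restrict_ext)
  then show ?thesis
    unfolding f_sharp_edge_def char_ker_bar[OF e] by simp
qed

lemma f_character_ring: "f \<in> K_ring \<Gamma> \<alpha> \<Longrightarrow> p \<in> verts \<Gamma> \<Longrightarrow> f p \<in> character_ring (carrier torus)"
  by (simp add: K_ring_def)

lemma Res_T_eq_sum_edges:
  assumes f: "f \<in> K_ring \<Gamma> \<alpha>" and p: "p \<in> verts \<Gamma>" and g: "g \<in> carrier torus"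
    and disj: "\<And>e e'. e \<in> out_arcs \<Gamma> p \<Longrightarrow> e' \<in> out_arcs \<Gamma> p \<Longrightarrow> e \<noteq> e' \<Longrightarrow> roots e g \<inter> roots e' g = {}"
    and r: "1 < r\<^sub>1" "0 < r\<^sub>2" "r\<^sub>2 < 1"
  shows "Res_T r\<^sub>1 r\<^sub>2 (f_sharp \<Gamma> \<alpha> \<xi> f p) g =
    (\<Sum>e\<in>out_arcs \<Gamma> p. - of_int (sgn (deg e)) * f_sharp_edge \<Gamma> \<alpha> T f e (T #>\<^bsub>torus\<^esub> g))"
proof -
  obtain A and m :: "((real^'n) \<Rightarrow>\<^sub>L real) \<Rightarrow> int" where A: "finite A" "A \<subseteq> weight_lattice"
    "\<And>h. h \<in> carrier torus \<Longrightarrow> f p h = (\<Sum>a\<in>A. of_int (m a) * torus_char a h)"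
    by (rule character_ring_torusE[OF f_character_ring[OF f p]]) blast
  define P where "P z = (\<Sum>a\<in>A. of_int (m a) * char_ext \<xi> a g z)" for z
  have holP: "P holomorphic_on -{0}"
    unfolding P_def by (intro holomorphic_intros holomorphic_on_char_ext) auto
  have ringP: "ring_ext \<xi> (f p) g z = P z" if "z \<noteq> 0" for z
    unfolding P_def using ring_ext_eq[OF A xi_lattice g that] .
  have P_unit: "P z = f p (g * cp z)" if "norm z = 1" for z
    unfolding P_def A(3)[OF mult_cp_in_carrier[OF g that]]
    using torus_char_circle_param[OF _ xi_lattice g that] A(2) by (intro sum.cong) auto
  \<comment> \<open>The contour avoids 0, so on it \<open>ring_ext\<close> may be replaced by the
    Laurent polynomial \<open>P\<close>, for which holomorphy is known.\<close>
  have "contour_integral (circlepath 0 r) (\<lambda>z. f_sharp \<Gamma> \<alpha> \<xi> f p g z / z) =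
      contour_integral (circlepath 0 r) (\<lambda>z. P z *
        (\<Prod>e\<in>out_arcs \<Gamma> p. inverse (1 - torus_char (\<alpha> e) g * z powi deg e)) / z)" if "r > 0" for r
  proof (rule contour_integral_eq)
    fix z assume "z \<in> path_image (circlepath 0 r)"
    then have z: "z \<noteq> 0" using that by auto
    show "f_sharp \<Gamma> \<alpha> \<xi> f p g z / z = P z *
        (\<Prod>e\<in>out_arcs \<Gamma> p. inverse (1 - torus_char (\<alpha> e) g * z powi deg e)) / z"
      by (simp only: f_sharp_def ringP[OF z] char_ext_def)
  qed
  then have "Res_T r\<^sub>1 r\<^sub>2 (f_sharp \<Gamma> \<alpha> \<xi> f p) g =
      (\<Sum>e\<in>out_arcs \<Gamma> p. - (1 / of_int (deg e)) * (\<Sum>z\<in>roots e g.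
         P z * (\<Prod>e'\<in>out_arcs \<Gamma> p - {e}. inverse (1 - torus_char (\<alpha> e') g * z powi deg e'))))"
    unfolding Res_T_def using r deg_pos_iff(1)
    by (simp only: ) (intro circle_residue_difference holP disj, auto)
  also have "\<dots> = (\<Sum>e\<in>out_arcs \<Gamma> p. - of_int (sgn (deg e)) * f_sharp_edge \<Gamma> \<alpha> T f e (T #>\<^bsub>torus\<^esub> g))"
  proof (intro sum.cong refl)
    fix e assume e: "e \<in> out_arcs \<Gamma> p"
    have "P z * (\<Prod>e'\<in>out_arcs \<Gamma> p - {e}. inverse (1 - torus_char (\<alpha> e') g * z powi deg e')) =
        f_hat \<Gamma> \<alpha> f e (g * cp z)" if z: "z \<in> roots e g" for z
    proof -
      have z1: "norm z = 1" using z by (simp add: unit_roots_def)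
      have "torus_char (\<alpha> e') g * z powi deg e' = torus_char (\<alpha> e') (g * cp z)" if "e' \<in> arcs \<Gamma>" for e'
        using torus_char_circle_param[OF weight_edge[OF that] xi_lattice g z1] by (simp add: char_ext_def)
      then show ?thesis
        using e by (auto simp: f_hat_def P_unit[OF z1] intro!: prod.cong)
    qed
    then have "(\<Sum>z\<in>roots e g. P z *
        (\<Prod>e'\<in>out_arcs \<Gamma> p - {e}. inverse (1 - torus_char (\<alpha> e') g * z powi deg e'))) =
        (\<Sum>z\<in>roots e g. f_hat \<Gamma> \<alpha> f e (g * cp z))"
      by (rule sum.cong[OF refl])
    \<comment> \<open>The residues carry the weight \<open>- 1 / k\<close>, the push-forward the
      average \<open>1 / \<bar>k\<bar>\<close> over its finite kernel; the discrepancy is the sign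
      attached to the edge.\<close>
    moreover have "- (1 / complex_of_int k) = - of_int (sgn k) * (1 / of_int \<bar>k\<bar>)" for k
      by (auto simp: sgn_if abs_if)
    ultimately show "- (1 / of_int (deg e)) * (\<Sum>z\<in>roots e g.
         P z * (\<Prod>e'\<in>out_arcs \<Gamma> p - {e}. inverse (1 - torus_char (\<alpha> e') g * z powi deg e'))) =
        - of_int (sgn (deg e)) * f_sharp_edge \<Gamma> \<alpha> T f e (T #>\<^bsub>torus\<^esub> g)"
      using e g by (simp only: f_sharp_edge_eq in_out_arcs_conv mult.assoc)
  qed
  finally show ?thesis .
qed

text \<open>The points \<open>g\<close> for which \<open>z \<mapsto> f\<^sub>p\<^sup>#(gz)\<close> has only simple poles, at every vertex \<open>p\<close>.\<close>

definition generic :: "complex^'n \<Rightarrow> bool" where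
  "generic g \<longleftrightarrow> (\<forall>e\<in>arcs \<Gamma>. \<forall>e'\<in>arcs \<Gamma>. tail \<Gamma> e = tail \<Gamma> e' \<longrightarrow> e \<noteq> e' \<longrightarrow> roots e g \<inter> roots e' g = {})"

lemma chi_c_generic:
  assumes f: "f \<in> K_ring \<Gamma> \<alpha>" and g: "g \<in> carrier torus" and gen: "generic g"
    and c: "c \<notin> \<phi> ` verts \<Gamma>" and r: "1 < r\<^sub>1" "0 < r\<^sub>2" "r\<^sub>2 < 1"
  shows "chi_c \<Gamma> \<alpha> T \<phi> c f (T #>\<^bsub>torus\<^esub> g) =
    (\<Sum>p | p \<in> verts \<Gamma> \<and> \<phi> p > c. Res_T r\<^sub>1 r\<^sub>2 (f_sharp \<Gamma> \<alpha> \<xi> f p) g)"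
proof -
  define F where "F e = f_sharp_edge \<Gamma> \<alpha> T f e (T #>\<^bsub>torus\<^esub> g)" for e
  define G where "G e = - of_int (sgn (deg e)) * F e" for e
  have F_bar: "F (bar e) = F e" if "e \<in> arcs \<Gamma>" for e
    using f_sharp_edge_bar[OF that f] by (simp add: F_def)
  have G_bar: "G (bar e) = - G e" if "e \<in> arcs \<Gamma>" for e
    using F_bar[OF that] sgn_deg_bar[OF that] by (simp add: G_def)
  let ?V = "{p \<in> verts \<Gamma>. \<phi> p > c}"
  let ?S = "{e \<in> arcs \<Gamma>. \<phi> (tail \<Gamma> e) > c}"
  let ?S1 = "{e \<in> arcs \<Gamma>. \<phi> (tail \<Gamma> e) > c \<and> \<phi> (head \<Gamma> e) > c}"
  let ?S2 = "{e \<in> arcs \<Gamma>. \<phi> (tail \<Gamma> e) > c \<and> \<phi> (head \<Gamma> e) < c}"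
  have "(\<Sum>p\<in>?V. Res_T r\<^sub>1 r\<^sub>2 (f_sharp \<Gamma> \<alpha> \<xi> f p) g) = (\<Sum>p\<in>?V. \<Sum>e | e \<in> ?S \<and> tail \<Gamma> e = p. G e)"
  proof (rule sum.cong[OF refl])
    fix p assume p: "p \<in> ?V"
    have "Res_T r\<^sub>1 r\<^sub>2 (f_sharp \<Gamma> \<alpha> \<xi> f p) g = (\<Sum>e\<in>out_arcs \<Gamma> p. G e)"
      unfolding G_def F_def using p gen
      by (intro Res_T_eq_sum_edges f g r) (auto simp: generic_def)
    also have "out_arcs \<Gamma> p = {e \<in> ?S. tail \<Gamma> e = p}"
      using p by auto
    finally show "Res_T r\<^sub>1 r\<^sub>2 (f_sharp \<Gamma> \<alpha> \<xi> f p) g = (\<Sum>e | e \<in> ?S \<and> tail \<Gamma> e = p. G e)" .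
  qed
  also have "\<dots> = sum G ?S"
    by (rule sum.group) auto
  \<comment> \<open>Regularity of \<open>c\<close> excludes edges whose head lies on the level
    \<open>c\<close>.\<close>
  also have "?S = ?S1 \<union> ?S2"
    using c by (auto simp: not_less le_less)
  also have "sum G (?S1 \<union> ?S2) = sum G ?S1 + sum G ?S2"
    by (rule sum.union_disjoint) auto
  also have "sum G ?S1 = 0"
  proof -
    \<comment> \<open>Reversal permutes the edges inside the upper part and negates
      \<open>G\<close>, so this sum equals its own negative.\<close>
    have "sum G ?S1 = (\<Sum>e\<in>?S1. G (bar e))"
      by (rule sum.reindex_bij_witness[where i = bar and j = bar]) auto
    also have "\<dots> = - sum G ?S1"
      by (simp add: G_bar sum_negf)
    finally show ?thesis by simp
  qed
  \<comment> \<open>These edges descend through \<open>c\<close>, so \<open>deg\<close> is negative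
    and the two minus signs in \<open>G\<close> cancel; their reverses are exactly the edges in
    \<open>cross_edges\<close>.\<close>
  also have "sum G ?S2 = sum F (cross_edges \<Gamma> \<phi> c)"
  proof (rule sum.reindex_bij_witness[where i = bar and j = bar])
    fix e assume e: "e \<in> ?S2"
    then have "deg e < 0" using deg_pos_iff[of e] by (smt (verit) mem_Collect_eq)
    then show "F (bar e) = G e" using e by (simp add: F_bar G_def)
  qed (auto simp: cross_edges_def)
  finally show ?thesis by (simp add: chi_c_def F_def)
qed

end

section \<open>Avoiding integral values and finitely many hyperplanes\<close>

lemma eventually_not_Ints:
  fixes a b :: real
  assumes "b \<noteq> 0" shows "\<forall>\<^sub>F t in at 0. a + t * b \<notin> \<int>"
proof -
  have "\<forall>\<^sub>F x in at a. x \<notin> \<int>"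
  proof (cases "a \<in> \<int>")
    case True
    then obtain n where n: "a = of_int n" by (elim Ints_cases)
    have "x \<notin> \<int>" if "x \<noteq> a" "dist x a < 1" for x
    proof
      assume "x \<in> \<int>"
      then obtain k where "x = of_int k" by (elim Ints_cases)
      with that n show False by (simp add: dist_real_def flip: of_int_diff of_int_abs)
    qed
    then show ?thesis unfolding eventually_at by (intro exI[of _ 1]) auto
  next
    case False
    have "closed (\<int> :: real set)" by (rule closed_Ints)
    then have "\<forall>\<^sub>F x in nhds a. x \<in> - \<int>"
      using False by (intro eventually_nhds_in_open) auto
    then show ?thesis by (simp add: eventually_at_filter eventually_mono)
  qed
  \<comment> \<open>A nonconstant affine map sends punctured neighbourhoods of 0 to punctured
    neighbourhoods of \<open>a\<close>, so \<open>a\<close> itself may be an integer.\<close>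
  moreover have "filterlim (\<lambda>t. a + t * b) (at a) (at 0)"
  proof (rule filterlim_atI)
    have "((\<lambda>t. a + t * b) \<longlongrightarrow> a + 0 * b) (at 0)" by (intro tendsto_intros)
    then show "((\<lambda>t. a + t * b) \<longlongrightarrow> a) (at 0)" by simp
    show "\<forall>\<^sub>F t in at 0. a + t * b \<noteq> a"
      using assms by (auto simp: eventually_at_filter)
  qed
  ultimately show ?thesis by (rule eventually_compose_filterlim)
qed

text \<open>A real vector space is not a finite union of hyperplanes. A vector good for
  \<open>B\<close> is perturbed by a multiple of some \<open>w\<close> with \<open>b w\<close>
  nonzero, avoiding finitely many multiples.\<close>

lemma ex_common_nonzero:
  fixes B :: "('a::real_normed_vector \<Rightarrow>\<^sub>L real) set"
  assumes "finite B" "0 \<notin> B" obtains v where "\<And>b. b \<in> B \<Longrightarrow> blinfun_apply b v \<noteq> 0"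
proof -
  have "\<exists>v. \<forall>b\<in>B. blinfun_apply b v \<noteq> 0"
    using assms
  proof (induction B rule: finite_induct)
    case (insert b B)
    then obtain v where v: "\<forall>b\<in>B. blinfun_apply b v \<noteq> 0" by auto
    from insert have "b \<noteq> 0" by auto
    then obtain w where w: "blinfun_apply b w \<noteq> 0" by (metis blinfun_eqI zero_blinfun.rep_eq)
    have "finite ((\<lambda>b. - blinfun_apply b v / blinfun_apply b w) ` insert b B)"
      using insert by simp
    then obtain s :: real where s: "s \<notin> (\<lambda>b. - blinfun_apply b v / blinfun_apply b w) ` insert b B"
      using ex_new_if_finite[OF infinite_UNIV_char_0] by blast
    have "blinfun_apply b' (v + s *\<^sub>R w) \<noteq> 0" if b': "b' \<in> insert b B" for b'
    \<comment> \<open>If \<open>b'\<close> vanishes at \<open>w\<close> then it is not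
      \<open>b\<close>, so it lies in \<open>B\<close> and its value at \<open>v\<close> is kept;
      otherwise a single value of \<open>s\<close> is bad for \<open>b'\<close>.\<close>
    proof (cases "blinfun_apply b' w = 0")
      case True
      then show ?thesis using v w b' by (auto simp: blinfun.add_right blinfun.scaleR_right)
    next
      case False
      have "s \<noteq> - blinfun_apply b' v / blinfun_apply b' w" using s b' by blast
      with False show ?thesis
        by (simp add: blinfun.add_right blinfun.scaleR_right field_simps eq_neg_iff_add_eq_0)
    qed
    then show ?case by blast
  qed auto
  then show ?thesis using that by blast
qed

section \<open>Density of the generic points\<close>

lemma torus_char_path:
  assumes "a \<in> weight_lattice" "g \<in> carrier torus"
  shows "torus_char a (g * torus_exp (t *\<^sub>R v)) = torus_char a g * cis (2 * pi * (t * blinfun_apply a v))"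
  using assms by (simp add: torus_char_mult torus_char_exp blinfun.scaleR_right)

lemma continuous_on_mult_circle_param:
  assumes "S \<subseteq> UNIV \<times> - {0}"
  shows "continuous_on S (\<lambda>(h, z). h * circle_param \<xi> z)"
proof -
  have "continuous_on S (\<lambda>x. \<chi> i. fst x $ i * (snd x) powi \<lfloor>\<xi> $ i\<rfloor>)"
    using assms by (intro continuous_intros) auto
  moreover have "(\<lambda>x. \<chi> i. fst x $ i * (snd x) powi \<lfloor>\<xi> $ i\<rfloor>) = (\<lambda>(h, z). h * circle_param \<xi> z)"
    by (auto simp: fun_eq_iff cart_eq_iff circle_param_def)
  ultimately show ?thesis by (simp only:)
qed

context GKM_circle_action
begin

text \<open>This is where the GKM condition enters: as \<open>deg e'\<close> is nonzero, a vanishing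
  combination would put \<open>\<alpha> e\<close> on the line spanned by
  \<open>\<alpha> e'\<close>.\<close>

lemma weight_combination_nonzero:
  assumes e: "e \<in> arcs \<Gamma>" "e' \<in> arcs \<Gamma>" "tail \<Gamma> e = tail \<Gamma> e'" "e \<noteq> e'"
  shows "real_of_int (deg e') *\<^sub>R \<alpha> e - real_of_int (deg e) *\<^sub>R \<alpha> e' \<noteq> 0"
proof
  assume "real_of_int (deg e') *\<^sub>R \<alpha> e - real_of_int (deg e) *\<^sub>R \<alpha> e' = 0"
  then have "real_of_int (deg e') *\<^sub>R \<alpha> e \<in> span {\<alpha> e'}"
    by (simp add: span_base span_mul)
  then have "inverse (real_of_int (deg e')) *\<^sub>R real_of_int (deg e') *\<^sub>R \<alpha> e \<in> span {\<alpha> e'}"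
    by (rule span_mul)
  then have "\<alpha> e \<in> span {\<alpha> e'}"
    using deg_pos_iff(1)[OF e(2)] by simp
  moreover have "\<alpha> e \<noteq> \<alpha> e'" "independent {\<alpha> e, \<alpha> e'}"
    using GKM[OF e(1,2,4,3)] by auto
  ultimately show False
    by (simp add: independent_insert)
qed

text \<open>Eliminating \<open>z\<close> from the root equations of two edges leaves one equation:
  the character with weight \<open>b e e'\<close> takes the value 1. Along a direction on which no
  \<open>b e e'\<close> vanishes this fails for all small nonzero \<open>t\<close>. The direction
  depends only on the weights, not on \<open>g\<close>.\<close>

lemma ex_generic_direction:
  obtains v where "\<And>g. g \<in> carrier torus \<Longrightarrow> \<forall>\<^sub>F t in at 0. generic (g * torus_exp (t *\<^sub>R v))"
proof -
  define b where "b e e' = real_of_int (deg e') *\<^sub>R \<alpha> e - real_of_int (deg e) *\<^sub>R \<alpha> e'" for e e'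
  let ?I = "{(e, e'). e \<in> arcs \<Gamma> \<and> e' \<in> arcs \<Gamma> \<and> tail \<Gamma> e = tail \<Gamma> e' \<and> e \<noteq> e'}"
  have "finite ?I"
    by (rule finite_subset[of _ "arcs \<Gamma> \<times> arcs \<Gamma>"]) auto
  then have "finite ((\<lambda>(e, e'). b e e') ` ?I)" by simp
  moreover have "0 \<notin> (\<lambda>(e, e'). b e e') ` ?I"
    using weight_combination_nonzero unfolding b_def by fastforce
  ultimately obtain v where v: "\<And>\<beta>. \<beta> \<in> (\<lambda>(e, e'). b e e') ` ?I \<Longrightarrow> blinfun_apply \<beta> v \<noteq> 0"
    by (rule ex_common_nonzero) blast
  have "\<forall>\<^sub>F t in at 0. generic (g * torus_exp (t *\<^sub>R v))" if g: "g \<in> carrier torus" for g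
  proof -
    obtain x where x: "torus_exp x = g" using torus_exp_surj[OF g] .
    have "\<forall>\<^sub>F t in at 0. tail \<Gamma> e = tail \<Gamma> e' \<longrightarrow> e \<noteq> e' \<longrightarrow>
        roots e (g * torus_exp (t *\<^sub>R v)) \<inter> roots e' (g * torus_exp (t *\<^sub>R v)) = {}"
      if e: "e \<in> arcs \<Gamma>" "e' \<in> arcs \<Gamma>" for e e'
    proof (cases "tail \<Gamma> e = tail \<Gamma> e' \<and> e \<noteq> e'")
      case True
      then have "blinfun_apply (b e e') v \<noteq> 0" using v e by blast
      then have "\<forall>\<^sub>F t in at 0. blinfun_apply (b e e') x + t * blinfun_apply (b e e') v \<notin> \<int>"
        by (rule eventually_not_Ints)
      then show ?thesis
      proof eventually_elim
        case (elim t)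
        define y where "y = x + t *\<^sub>R v"
        have y: "g * torus_exp (t *\<^sub>R v) = torus_exp y" by (simp add: y_def torus_exp_add x)
        have "z \<notin> roots e' (torus_exp y)" if z: "z \<in> roots e (torus_exp y)" for z
        proof
          assume z': "z \<in> roots e' (torus_exp y)"
          let ?c = "cis (2 * pi * blinfun_apply (\<alpha> e) y)" and ?c' = "cis (2 * pi * blinfun_apply (\<alpha> e') y)"
          have nz: "z \<noteq> 0" and 1: "?c * z powi deg e = 1" "?c' * z powi deg e' = 1"
            using z z' weight_edge e by (auto simp: unit_roots_def torus_char_exp)
          \<comment> \<open>Raising the two equations to the powers \<open>deg e'\<close> and
            \<open>deg e\<close> gives \<open>z\<close> the same exponent in both.\<close>
          have "?c powi deg e' * z powi (deg e * deg e') = (?c * z powi deg e) powi deg e'"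
            by (simp only: power_int_mult_distrib power_int_mult)
          also have "\<dots> = (?c' * z powi deg e') powi deg e"
            by (simp only: 1 power_int_1_left)
          also have "\<dots> = ?c' powi deg e * z powi (deg e * deg e')"
            by (simp only: power_int_mult_distrib power_int_mult mult.commute[of "deg e"])
          finally have "?c powi deg e' = ?c' powi deg e"
            using nz by simp
          then have "cis (of_int (deg e') * (2 * pi * blinfun_apply (\<alpha> e) y)) /
              cis (of_int (deg e) * (2 * pi * blinfun_apply (\<alpha> e') y)) = 1"
            by (simp add: cis_power_int)
          then have "cis (2 * pi * blinfun_apply (b e e') y) = 1"
            by (simp only: cis_divide b_def blinfun.diff_left blinfun.scaleR_left real_scaleR_def
                right_diff_distrib mult.left_commute mult.assoc)
          with elim show False
            by (simp only: cis_2pi_eq_1_iff y_def blinfun.add_right blinfun.scaleR_right real_scaleR_def)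
        qed
        then show ?case unfolding y by blast
      qed
    qed auto
    then show ?thesis
      unfolding generic_def by (intro eventually_ball_finite finite_arcs ballI)
  qed
  then show ?thesis by (rule that)
qed

section \<open>Continuity along one-parameter subgroups\<close>

lemma path_in_carrier: "g \<in> carrier torus \<Longrightarrow> g * torus_exp v \<in> carrier torus"
  by (simp add: torus_mult_closed)

text \<open>On a circle of radius \<open>r\<close> other than 1 each extended edge character has
  norm \<open>r powi deg e\<close>, which is not 1. The integrand is thus jointly continuous, even
  at points where poles on the unit circle collide.\<close>

lemma continuous_on_Res_T_path:
  assumes f: "f \<in> K_ring \<Gamma> \<alpha>" and p: "p \<in> verts \<Gamma>" and g: "g \<in> carrier torus"
    and r: "1 < r\<^sub>1" "0 < r\<^sub>2" "r\<^sub>2 < 1"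
  shows "continuous_on UNIV (\<lambda>t. Res_T r\<^sub>1 r\<^sub>2 (f_sharp \<Gamma> \<alpha> \<xi> f p) (g * torus_exp (t *\<^sub>R v)))"
proof -
  obtain A and m :: "((real^'n) \<Rightarrow>\<^sub>L real) \<Rightarrow> int" where A: "finite A" "A \<subseteq> weight_lattice"
    "\<And>h. h \<in> carrier torus \<Longrightarrow> f p h = (\<Sum>a\<in>A. of_int (m a) * torus_char a h)"
    by (rule character_ring_torusE[OF f_character_ring[OF f p]]) blast
  have "continuous_on UNIV (\<lambda>t. contour_integral (circlepath 0 r)
      (\<lambda>z. f_sharp \<Gamma> \<alpha> \<xi> f p (g * torus_exp (t *\<^sub>R v)) z / z))" if r: "r > 0" "r \<noteq> 1" for r
  proof (rule continuous_on_contour_integral_circlepath[OF _ r(1)])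
    define E where "E a x = torus_char a g * cis (2 * pi * (fst x * blinfun_apply a v)) *
      (snd x) powi \<lfloor>blinfun_apply a \<xi>\<rfloor>" for a and x :: "real \<times> complex"
    have E: "char_ext \<xi> a (g * torus_exp (t *\<^sub>R v)) z = E a (t, z)" if "a \<in> weight_lattice" for a t z
      by (simp add: char_ext_def E_def torus_char_path[OF that g])
    have E_cont: "continuous_on (UNIV \<times> sphere 0 r) (E a)" for a
      unfolding E_def cis_conv_exp using r by (intro continuous_intros) auto
    have E_ne: "1 - E (\<alpha> e) x \<noteq> 0" if "e \<in> arcs \<Gamma>" "x \<in> UNIV \<times> sphere 0 r" for e x
    proof
      assume "1 - E (\<alpha> e) x = 0"
      then have "norm (E (\<alpha> e) x) = 1" by (metis eq_iff_diff_eq_0 norm_one)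
      then have "r powi deg e = 1"
        using that(2) by (auto simp: E_def norm_mult norm_power_int)
      then show False
        using real_powi_eq_1[of r "deg e"] r deg_pos_iff(1)[OF that(1)] by simp
    qed
    have "continuous_on (UNIV \<times> sphere 0 r) (\<lambda>x. (\<Sum>a\<in>A. of_int (m a) * E a x) *
        (\<Prod>e\<in>out_arcs \<Gamma> p. inverse (1 - E (\<alpha> e) x)) / snd x)"
      using E_ne r by (intro continuous_intros E_cont) auto
    then show "continuous_on (UNIV \<times> sphere 0 r)
        (\<lambda>(t, z). f_sharp \<Gamma> \<alpha> \<xi> f p (g * torus_exp (t *\<^sub>R v)) z / z)"
    proof (rule continuous_on_eq)
      fix x :: "real \<times> complex" assume "x \<in> UNIV \<times> sphere 0 r"
      then obtain t z where x: "x = (t, z)" "z \<noteq> 0" using r by auto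
      have "ring_ext \<xi> (f p) (g * torus_exp (t *\<^sub>R v)) z = (\<Sum>a\<in>A. of_int (m a) * E a (t, z))"
      proof -
        have "ring_ext \<xi> (f p) (g * torus_exp (t *\<^sub>R v)) z =
            (\<Sum>a\<in>A. of_int (m a) * char_ext \<xi> a (g * torus_exp (t *\<^sub>R v)) z)"
          by (rule ring_ext_eq[OF A xi_lattice path_in_carrier[OF g] x(2)])
        also have "\<dots> = (\<Sum>a\<in>A. of_int (m a) * E a (t, z))"
          using A(2) E by (intro sum.cong) auto
        finally show ?thesis .
      qed
      moreover have "(\<Prod>e\<in>out_arcs \<Gamma> p. inverse (1 - char_ext \<xi> (\<alpha> e) (g * torus_exp (t *\<^sub>R v)) z)) =
          (\<Prod>e\<in>out_arcs \<Gamma> p. inverse (1 - E (\<alpha> e) (t, z)))"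
        using E weight_edge by (intro prod.cong) auto
      ultimately show "(\<Sum>a\<in>A. of_int (m a) * E a x) *
          (\<Prod>e\<in>out_arcs \<Gamma> p. inverse (1 - E (\<alpha> e) x)) / snd x =
          (case x of (t, z) \<Rightarrow> f_sharp \<Gamma> \<alpha> \<xi> f p (g * torus_exp (t *\<^sub>R v)) z / z)"
        by (simp add: x(1) f_sharp_def)
    qed
  qed
  then show ?thesis
    unfolding Res_T_def using r by (intro continuous_intros) auto
qed

lemma isCont_f_hat_path:
  assumes f: "f \<in> K_ring \<Gamma> \<alpha>" and e: "e \<in> arcs \<Gamma>" and h: "h \<in> carrier torus"
    and ne: "\<And>e'. e' \<in> out_arcs \<Gamma> (tail \<Gamma> e) - {e} \<Longrightarrow> torus_char (\<alpha> e') h \<noteq> 1"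
  shows "isCont (\<lambda>t. f_hat \<Gamma> \<alpha> f e (h * torus_exp (t *\<^sub>R u))) 0"
proof -
  obtain A and m :: "((real^'n) \<Rightarrow>\<^sub>L real) \<Rightarrow> int" where A: "finite A" "A \<subseteq> weight_lattice"
    "\<And>h. h \<in> carrier torus \<Longrightarrow> f (tail \<Gamma> e) h = (\<Sum>a\<in>A. of_int (m a) * torus_char a h)"
    by (rule character_ring_torusE[OF f_character_ring[OF f tail_in_verts[OF e]]]) blast
  have "f_hat \<Gamma> \<alpha> f e (h * torus_exp (t *\<^sub>R u)) =
      (\<Sum>a\<in>A. of_int (m a) * (torus_char a h * cis (2 * pi * (t * blinfun_apply a u)))) *
      (\<Prod>e'\<in>out_arcs \<Gamma> (tail \<Gamma> e) - {e}.
         inverse (1 - torus_char (\<alpha> e') h * cis (2 * pi * (t * blinfun_apply (\<alpha> e') u))))" for t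
    unfolding f_hat_def A(3)[OF path_in_carrier[OF h]]
    using torus_char_path[OF _ h] A(2) weight_edge
    by (intro arg_cong2[of _ _ _ _ "(*)"] sum.cong prod.cong) auto
  then show ?thesis
    using ne unfolding cis_conv_exp by (simp only:) (intro continuous_intros, auto)
qed

text \<open>The vector \<open>u\<close> is the modification of \<open>v\<close> by a multiple of
  \<xi> with \<open>\<alpha> e\<close> zero on it. Moving along \<open>u\<close> gives the same
  cosets of \<open>T\<close> as moving along \<open>v\<close>, but points of the kernel stay in the
  kernel, so the index set of the sum no longer depends on \<open>t\<close>.\<close>

lemma f_sharp_edge_path:
  fixes v :: "real^'n"
  assumes e: "e \<in> arcs \<Gamma>" and g: "g \<in> carrier torus"
  defines "u \<equiv> v - (blinfun_apply (\<alpha> e) v / of_int (deg e)) *\<^sub>R \<xi>"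
  shows "f_sharp_edge \<Gamma> \<alpha> T f e (T #>\<^bsub>torus\<^esub> (g * torus_exp (t *\<^sub>R v))) =
    1 / of_int \<bar>deg e\<bar> * (\<Sum>z\<in>roots e g. f_hat \<Gamma> \<alpha> f e (g * cp z * torus_exp (t *\<^sub>R u)))"
proof -
  \<comment> \<open>Chosen so that \<open>w powi deg e\<close> undoes the change of the edge
    character along \<open>v\<close>; multiplication by \<open>w\<close> then carries the roots at
    time 0 to those at time \<open>t\<close>.\<close>
  define s where "s = - (t * blinfun_apply (\<alpha> e) v / of_int (deg e))"
  define w where "w = cis (2 * pi * s)"
  let ?gt = "g * torus_exp (t *\<^sub>R v)"
  have norm_w: "norm w = 1" "w \<noteq> 0" by (auto simp: w_def)
  have w_deg: "cis (2 * pi * (t * blinfun_apply (\<alpha> e) v)) * w powi deg e = 1"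
    using deg_pos_iff(1)[OF e] by (simp add: w_def s_def cis_power_int cis_mult)
  have roots_gt: "z * w \<in> roots e ?gt \<longleftrightarrow> z \<in> roots e g" for z
  proof -
    have "torus_char (\<alpha> e) ?gt * (z * w) powi deg e = torus_char (\<alpha> e) g * z powi deg e *
        (cis (2 * pi * (t * blinfun_apply (\<alpha> e) v)) * w powi deg e)"
      by (simp only: torus_char_path[OF weight_edge[OF e] g] power_int_mult_distrib mult_ac)
    then show ?thesis by (simp add: w_deg unit_roots_def norm_mult norm_w)
  qed
  have bij: "bij_betw (\<lambda>z. z * w) (roots e g) (roots e ?gt)"
    using roots_gt[of "_ / w"] roots_gt norm_w by (intro bij_betwI[where g = "\<lambda>z. z / w"]) auto
  have gt: "?gt * cp (z * w) = g * cp z * torus_exp (t *\<^sub>R u)" for z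
  proof -
    have "cp w = torus_exp (s *\<^sub>R \<xi>)" unfolding w_def by (rule circle_param_cis[OF xi_lattice])
    moreover have "t *\<^sub>R u = t *\<^sub>R v + s *\<^sub>R \<xi>"
      by (simp add: u_def s_def scaleR_right_diff_distrib)
    ultimately show ?thesis by (simp add: circle_param_mult torus_exp_add mult_ac)
  qed
  show ?thesis
    unfolding f_sharp_edge_eq[OF e path_in_carrier[OF g]]
    unfolding sum.reindex_bij_betw[OF bij, symmetric] gt ..
qed

lemma tendsto_f_sharp_edge_path:
  assumes f: "f \<in> K_ring \<Gamma> \<alpha>" and e: "e \<in> arcs \<Gamma>" and g: "g \<in> carrier torus"
    and ne: "\<And>z e'. z \<in> roots e g \<Longrightarrow> e' \<in> out_arcs \<Gamma> (tail \<Gamma> e) - {e} \<Longrightarrow> torus_char (\<alpha> e') (g * cp z) \<noteq> 1"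
  shows "((\<lambda>t. f_sharp_edge \<Gamma> \<alpha> T f e (T #>\<^bsub>torus\<^esub> (g * torus_exp (t *\<^sub>R v)))) \<longlongrightarrow>
    f_sharp_edge \<Gamma> \<alpha> T f e (T #>\<^bsub>torus\<^esub> g)) (at 0)"
proof -
  have "isCont (\<lambda>t. f_sharp_edge \<Gamma> \<alpha> T f e (T #>\<^bsub>torus\<^esub> (g * torus_exp (t *\<^sub>R v)))) 0"
    unfolding f_sharp_edge_path[OF e g]
    by (intro continuous_intros isCont_f_hat_path f e mult_cp_in_carrier g ne)
       (auto simp: unit_roots_def)
  then show ?thesis by (simp add: isCont_def)
qed

section \<open>The domain of the edge sum is open and dense\<close>

lemma coset_in_domain_iff:
  assumes g: "g \<in> carrier torus"
  shows "T #>\<^bsub>torus\<^esub> g \<in> chi_c_domain \<Gamma> \<alpha> T \<phi> c \<longleftrightarrow>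
    (\<forall>e\<in>cross_edges \<Gamma> \<phi> c. \<forall>z\<in>roots e g. \<forall>e'\<in>out_arcs \<Gamma> (tail \<Gamma> e) - {e}.
       torus_char (\<alpha> e') (g * cp z) \<noteq> 1)"
proof -
  have "(T #>\<^bsub>torus\<^esub> g) \<inter> char_ker (\<alpha> e) = (\<lambda>z. g * cp z) ` roots e g" if "e \<in> arcs \<Gamma>" for e
    using roots_iff[OF that g] by (auto simp: coset_eq unit_roots_def)
  moreover have "T #>\<^bsub>torus\<^esub> g \<in> carrier (torus Mod T)"
    using g by (auto simp: FactGroup_def RCOSETS_def)
  ultimately show ?thesis
    unfolding chi_c_domain_def by (auto simp: cross_edges_def)
qed

text \<open>A denominator vanishing at a point of the coset in the kernel of
  \<open>\<alpha> e\<close> is a common root of \<open>e\<close> and another edge at the same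
  vertex.\<close>

lemma generic_coset_in_domain:
  assumes g: "g \<in> carrier torus" and gen: "generic g"
  shows "T #>\<^bsub>torus\<^esub> g \<in> chi_c_domain \<Gamma> \<alpha> T \<phi> c"
  unfolding coset_in_domain_iff[OF g]
proof (intro ballI notI)
  fix e z e' assume e: "e \<in> cross_edges \<Gamma> \<phi> c" and z: "z \<in> roots e g"
    and e': "e' \<in> out_arcs \<Gamma> (tail \<Gamma> e) - {e}" and 1: "torus_char (\<alpha> e') (g * cp z) = 1"
  have "norm z = 1" using z by (simp add: unit_roots_def)
  then have "z \<in> roots e' g"
    using roots_iff[of e' g z] e' g 1 by (simp add: mem_char_ker mult_cp_in_carrier)
  with z e e' gen show False by (force simp: generic_def cross_edges_def)
qed

text \<open>The preimage of the complement is a finite union of sets \<open>B e e'\<close>, the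
  common kernels of two edge characters swept along \<open>T\<close>. Each is a continuous image of
  a compact set, hence closed.\<close>

lemma openin_chi_c_domain: "openin (coset_topology T) (chi_c_domain \<Gamma> \<alpha> T \<phi> c)"
proof -
  define N where "N e e' = {h \<in> carrier torus. torus_char (\<alpha> e) h = 1} \<inter>
    {h \<in> carrier torus. torus_char (\<alpha> e') h = 1}" for e e'
  define B where "B e e' = (\<lambda>(h, z). h * cp z) ` (N e e' \<times> sphere 0 1)" for e e'

  let ?C = "\<Union>e\<in>cross_edges \<Gamma> \<phi> c. \<Union>e'\<in>out_arcs \<Gamma> (tail \<Gamma> e) - {e}. B e e'"
  have B_closed: "closed (B e e')" if "e \<in> arcs \<Gamma>" "e' \<in> arcs \<Gamma>" for e e'
  proof -
    have "compact {h \<in> carrier torus. torus_char (\<alpha> e) h = 1}" if "e \<in> arcs \<Gamma>" for e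
    proof -
      have "closed {h \<in> carrier torus. torus_char (\<alpha> e) h = 1}"
        by (rule continuous_closed_preimage_constant[OF continuous_on_torus_char[OF weight_edge[OF that]]
              compact_imp_closed[OF compact_carrier_torus]])
      from compact_Int_closed[OF compact_carrier_torus this] show ?thesis
        by (rule back_subst[of compact]) blast
    qed
    then have "compact (B e e')"
      using that unfolding B_def N_def
      by (intro compact_continuous_image continuous_on_mult_circle_param compact_Times compact_Int compact_sphere) auto
    then show ?thesis by (rule compact_imp_closed)
  qed
  have "finite (cross_edges \<Gamma> \<phi> c)"
    by (rule finite_subset[OF _ finite_arcs]) (auto simp: cross_edges_def)
  then have "closed ?C"
    using B_closed by (intro closed_UN ballI) (auto simp: cross_edges_def intro!: closed_UN)
  moreover have "{g \<in> carrier torus. T #>\<^bsub>torus\<^esub> g \<in> chi_c_domain \<Gamma> \<alpha> T \<phi> c} = carrier torus \<inter> - ?C"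
  proof (intro equalityI subsetI)
    fix g assume "g \<in> {g \<in> carrier torus. T #>\<^bsub>torus\<^esub> g \<in> chi_c_domain \<Gamma> \<alpha> T \<phi> c}"
    then have g: "g \<in> carrier torus" and D: "T #>\<^bsub>torus\<^esub> g \<in> chi_c_domain \<Gamma> \<alpha> T \<phi> c" by auto
    have "g \<notin> ?C"
    proof
      assume "g \<in> ?C"
      then obtain e e' where e: "e \<in> cross_edges \<Gamma> \<phi> c" "e' \<in> out_arcs \<Gamma> (tail \<Gamma> e) - {e}"
        and "g \<in> B e e'" by (elim UN_E)
      then obtain h z where h: "h \<in> N e e'" and z: "z \<in> sphere 0 1" "g = h * cp z"
        by (auto simp: B_def)
      \<comment> \<open>Multiplication by \<open>cp (inverse z)\<close> undoes the sweep and returns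
        to the point \<open>h\<close> at which both characters are 1.\<close>
      have z1: "norm (inverse z) = 1" "z \<noteq> 0" using z(1) by (auto simp: norm_inverse)
      have "g * cp (inverse z) = h * cp (z * inverse z)"
        by (simp only: z(2) circle_param_mult mult.assoc)
      also have "cp (z * inverse z) = 1"
        using z1(2) by (simp add: circle_param_def cart_eq_iff)
      finally have h_eq: "g * cp (inverse z) = h" by simp
      have "inverse z \<in> roots e g"
        using roots_iff[OF _ g z1(1)] e(1) h by (simp add: h_eq mem_char_ker N_def cross_edges_def)
      then have "torus_char (\<alpha> e') (g * cp (inverse z)) \<noteq> 1"
        using D e unfolding coset_in_domain_iff[OF g] by blast
      with h show False by (simp add: h_eq N_def)
    qed
    with g show "g \<in> carrier torus \<inter> - ?C" by blast
  next
    fix g assume "g \<in> carrier torus \<inter> - ?C"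
    then have g: "g \<in> carrier torus" and C: "g \<notin> ?C" by auto
    have "torus_char (\<alpha> e') (g * cp z) \<noteq> 1"
      if e: "e \<in> cross_edges \<Gamma> \<phi> c" "z \<in> roots e g" "e' \<in> out_arcs \<Gamma> (tail \<Gamma> e) - {e}" for e z e'
    proof
      assume 1: "torus_char (\<alpha> e') (g * cp z) = 1"
      have z: "norm z = 1" "z \<noteq> 0" using e(2) by (auto simp: unit_roots_def)
      have "g * cp z \<in> N e e'"
        using roots_iff[OF _ g z(1)] e 1 mult_cp_in_carrier[OF g z(1)] by (simp add: mem_char_ker cross_edges_def N_def)
      moreover have "g = g * cp z * cp (inverse z)"
        using z(2) by (simp add: circle_param_def cart_eq_iff power_int_inverse mult.assoc)
      moreover have "inverse z \<in> sphere 0 1" using z by (simp add: norm_inverse)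
      ultimately have "g \<in> B e e'"
        unfolding B_def by (intro image_eqI[of _ _ "(g * cp z, inverse z)"]) auto
      with C e show False by blast
    qed
    then show "g \<in> {g \<in> carrier torus. T #>\<^bsub>torus\<^esub> g \<in> chi_c_domain \<Gamma> \<alpha> T \<phi> c}"
      using g coset_in_domain_iff[OF g] by simp
  qed
  moreover have "chi_c_domain \<Gamma> \<alpha> T \<phi> c \<subseteq> carrier (torus Mod T)"
    by (auto simp: chi_c_domain_def)
  ultimately show ?thesis
    using openin_open_Int[of "- ?C" "carrier torus"] by (simp only: openin_coset_topology open_Compl)
qed

lemma tendsto_path: "((\<lambda>t. g * torus_exp (t *\<^sub>R v)) \<longlongrightarrow> g) (at 0)"
proof -
  have "((\<lambda>t. \<chi> i. g $ i * cis (2 * pi * (t * v $ i))) \<longlongrightarrow> (\<chi> i. g $ i * cis (2 * pi * (0 * v $ i)))) (at 0)"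
    unfolding cis_conv_exp by (intro tendsto_intros)
  moreover have "(\<chi> i. g $ i * cis (2 * pi * (t * v $ i))) = g * torus_exp (t *\<^sub>R v)" for t
    by (simp add: cart_eq_iff)
  moreover have "(\<chi> i. g $ i * cis (2 * pi * (0 * v $ i))) = g"
    by (simp add: cart_eq_iff)
  ultimately show ?thesis by simp
qed

lemma topspace_coset_topology: "topspace (coset_topology T) = carrier (torus Mod T)"
proof
  have "{g \<in> carrier torus. T #>\<^bsub>torus\<^esub> g \<in> carrier (torus Mod T)} = carrier torus"
    by (auto simp: FactGroup_def RCOSETS_def)
  then have "openin (coset_topology T) (carrier (torus Mod T))"
    by (simp add: openin_coset_topology)
  then show "carrier (torus Mod T) \<subseteq> topspace (coset_topology T)"
    by (rule openin_subset)
  show "topspace (coset_topology T) \<subseteq> carrier (torus Mod T)"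
    using openin_topspace[of "coset_topology T", unfolded openin_coset_topology] by blast
qed

lemma closure_chi_c_domain:
  "coset_topology T closure_of chi_c_domain \<Gamma> \<alpha> T \<phi> c = carrier (torus Mod T)"
proof
  show "coset_topology T closure_of chi_c_domain \<Gamma> \<alpha> T \<phi> c \<subseteq> carrier (torus Mod T)"
    using closure_of_subset_topspace topspace_coset_topology by metis
  show "carrier (torus Mod T) \<subseteq> coset_topology T closure_of chi_c_domain \<Gamma> \<alpha> T \<phi> c"
  proof
    fix X assume X: "X \<in> carrier (torus Mod T)"
    then obtain g where g: "g \<in> carrier torus" "X = T #>\<^bsub>torus\<^esub> g"
      by (auto simp: FactGroup_def RCOSETS_def)
    obtain v where v: "\<And>g. g \<in> carrier torus \<Longrightarrow> \<forall>\<^sub>F t in at 0. generic (g * torus_exp (t *\<^sub>R v))"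
      by (rule ex_generic_direction) blast
    have "\<exists>Y. Y \<in> chi_c_domain \<Gamma> \<alpha> T \<phi> c \<and> Y \<in> U" if U: "X \<in> U" "openin (coset_topology T) U" for U
    proof -
      obtain W where W: "open W" "{g \<in> carrier torus. T #>\<^bsub>torus\<^esub> g \<in> U} = carrier torus \<inter> W"
        using U(2) by (auto simp: openin_coset_topology openin_open)
      have "g \<in> W" using W(2) g U(1) by blast
      with topological_tendstoD[OF tendsto_path W(1)]
      have "\<forall>\<^sub>F t in at 0. g * torus_exp (t *\<^sub>R v) \<in> W" .
      with v[OF g(1)] have "\<forall>\<^sub>F t in at (0::real). \<exists>Y. Y \<in> chi_c_domain \<Gamma> \<alpha> T \<phi> c \<and> Y \<in> U"
      proof eventually_elim
        case (elim t)
        have "T #>\<^bsub>torus\<^esub> (g * torus_exp (t *\<^sub>R v)) \<in> U"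
          using W(2) elim(2) path_in_carrier[OF g(1)] by blast
        with generic_coset_in_domain[OF path_in_carrier[OF g(1)] elim(1)] show ?case by blast
      qed
      \<comment> \<open>The filter \<open>at 0\<close> is nontrivial, so an eventually true
        statement free of \<open>t\<close> is true.\<close>
      then show ?thesis using eventually_const[of "at (0::real)"] by simp
    qed
    then show "X \<in> coset_topology T closure_of chi_c_domain \<Gamma> \<alpha> T \<phi> c"
      using X by (simp add: in_closure_of topspace_coset_topology)
  qed
qed

text \<open>At a point of the domain that is not generic, poles may be multiple, and edge terms that
  cancel generically may have vanishing denominators. The limit is therefore taken in the already
  cancelled identity, where only crossing edges occur, and the domain condition controls exactly
  those.\<close>

lemma chi_c_eq_sum_Res:
  assumes f: "f \<in> K_ring \<Gamma> \<alpha>" and g: "g \<in> carrier torus"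
    and D: "T #>\<^bsub>torus\<^esub> g \<in> chi_c_domain \<Gamma> \<alpha> T \<phi> c"
    and c: "c \<notin> \<phi> ` verts \<Gamma>" and r: "1 < r\<^sub>1" "0 < r\<^sub>2" "r\<^sub>2 < 1"
  shows "chi_c \<Gamma> \<alpha> T \<phi> c f (T #>\<^bsub>torus\<^esub> g) =
    (\<Sum>p | p \<in> verts \<Gamma> \<and> \<phi> p > c. Res_T r\<^sub>1 r\<^sub>2 (f_sharp \<Gamma> \<alpha> \<xi> f p) g)"
proof -
  obtain v where v: "\<And>g. g \<in> carrier torus \<Longrightarrow> \<forall>\<^sub>F t in at 0. generic (g * torus_exp (t *\<^sub>R v))"
    by (rule ex_generic_direction) blast
  let ?R = "\<lambda>g. \<Sum>p | p \<in> verts \<Gamma> \<and> \<phi> p > c. Res_T r\<^sub>1 r\<^sub>2 (f_sharp \<Gamma> \<alpha> \<xi> f p) g"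
  have lim_chi: "((\<lambda>t. chi_c \<Gamma> \<alpha> T \<phi> c f (T #>\<^bsub>torus\<^esub> (g * torus_exp (t *\<^sub>R v)))) \<longlongrightarrow>
      chi_c \<Gamma> \<alpha> T \<phi> c f (T #>\<^bsub>torus\<^esub> g)) (at 0)"
    unfolding chi_c_def using D f g
    by (intro tendsto_intros tendsto_f_sharp_edge_path) (auto simp: coset_in_domain_iff cross_edges_def)
  have "isCont (\<lambda>t. ?R (g * torus_exp (t *\<^sub>R v))) 0"
    using continuous_on_Res_T_path[OF f _ g r] open_UNIV
    by (intro continuous_intros) (auto simp: continuous_on_eq_continuous_at)
  then have "((\<lambda>t. ?R (g * torus_exp (t *\<^sub>R v))) \<longlongrightarrow> ?R g) (at 0)"
    by (simp add: isCont_def)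
  moreover have "\<forall>\<^sub>F t in at 0. ?R (g * torus_exp (t *\<^sub>R v)) =
      chi_c \<Gamma> \<alpha> T \<phi> c f (T #>\<^bsub>torus\<^esub> (g * torus_exp (t *\<^sub>R v)))"
    using v[OF g] by eventually_elim (rule chi_c_generic[OF f path_in_carrier[OF g] _ c r, symmetric])
  ultimately have "((\<lambda>t. chi_c \<Gamma> \<alpha> T \<phi> c f (T #>\<^bsub>torus\<^esub> (g * torus_exp (t *\<^sub>R v)))) \<longlongrightarrow> ?R g) (at 0)"
    by (rule Lim_transform_eventually)
  from tendsto_unique[OF _ lim_chi this] show ?thesis by simp
qed

end

theorem theorem1p7:
  fixes \<Gamma> :: "('v, 'e) pre_digraph"
    and bar :: "'e \<Rightarrow> 'e"
    and d :: nat
    and \<rho> :: "'e \<Rightarrow> complex^'n \<Rightarrow> complex mat"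
    and \<alpha> :: "'e \<Rightarrow> (real^'n) \<Rightarrow>\<^sub>L real"
    and \<tau> :: "'v \<Rightarrow> complex^'n \<Rightarrow> complex mat"
    and T :: "(complex^'n) set"
    and \<xi> :: "real^'n"
    and \<phi> :: "'v \<Rightarrow> real"
    and c :: real
    and f :: "'v \<Rightarrow> complex^'n \<Rightarrow> complex"
    and r\<^sub>1 r\<^sub>2 :: real
  assumes "fin_digraph \<Gamma>" and "bidirected_digraph \<Gamma> bar" and "valent \<Gamma> d"
    and "GKM_action \<Gamma> bar d \<rho> \<alpha> \<tau>"
    and "circle_subgroup T" and "infinitesimal_generator T \<xi>"
    and "\<forall>e\<in>arcs \<Gamma>. \<not> T \<subseteq> char_ker (\<alpha> e)"
    and "moment_map \<Gamma> \<alpha> \<xi> \<phi>"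
    and "c \<notin> \<phi> ` verts \<Gamma>"
    and "f \<in> K_ring \<Gamma> \<alpha>"
    and "1 < r\<^sub>1" and "0 < r\<^sub>2" and "r\<^sub>2 < 1"
  shows "openin (coset_topology T) (chi_c_domain \<Gamma> \<alpha> T \<phi> c) \<and>
    coset_topology T closure_of chi_c_domain \<Gamma> \<alpha> T \<phi> c = carrier (torus Mod T) \<and>
    (\<forall>g\<in>carrier torus. T #>\<^bsub>torus\<^esub> g \<in> chi_c_domain \<Gamma> \<alpha> T \<phi> c \<longrightarrow>
       chi_c \<Gamma> \<alpha> T \<phi> c f (T #>\<^bsub>torus\<^esub> g) =
       (\<Sum>p | p \<in> verts \<Gamma> \<and> \<phi> p > c. Res_T r\<^sub>1 r\<^sub>2 (f_sharp \<Gamma> \<alpha> \<xi> f p) g))"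
proof -
  interpret GKM_circle_action \<Gamma> bar d \<rho> \<alpha> \<tau> T \<xi> \<phi>
    using assms by (intro GKM_circle_action.intro GKM_circle_action_axioms.intro)
  show ?thesis
    using openin_chi_c_domain closure_chi_c_domain chi_c_eq_sum_Res assms by blast
qed

end
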